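(* Let $G=(V,E)$ be a homogeneous graph on $V=\{1,\dots,m\}$ with vertices ordered so that $V\in S_H$. Then the family $\mathit{IW}_{Q_G}$ is contained in the family $\pi^{P_G}$: for every $U\in P_G$ and all real numbers $\alpha(C)$ ($C\in\mathcal{C}$), $\beta(S)$ ($S\in\mathcal{S}$) for which the density $\mathit{IW}_{Q_G}^{U,\alpha,\beta}$ on $P_G$ is normalizable, there exists $\alpha'\in\mathbb{R}^m$ with nonnegative entries such that $z_G(U,\alpha')<\infty$ and the $\mathit{IW}_{Q_G}^{U,\alpha,\beta}$ distribution equals $\pi^{P_G}_{U,\alpha'}$.
   Context: Edges are undirected, no loops. $G$ is homogeneous if for every $(i,j)\in E$, with $N[i]=\{i\}\cup\{u:(u,i)\in E\}$, either $N[j]\subseteq N[i]$ or $N[i]\subseteq N[j]$; such graphs are decomposable (no induced cycle of length at least four). $\mathcal{C}$ is the set of (maximal) cliques of $G$; for a perfect order $C_1,\dots,C_k$ of the cliques, the minimal separators are $S_j=(C_1\cup\dots\cup C_{j-1})\cap C_j$, $j=2,\dots,k$; $\mathcal{S}$ is the set of distinct separators and $\nu(S)$ is the number of $j$ with $S_j=S$. $P_G$ is the set of $m\times m$ symmetric positive definite matrices $\Sigma$ with $\Sigma_{ij}=0$ whenever $i\ne j$ and $(i,j)\notin E$. $\mathcal{L}_G$ is the set of lower-triangular $m\times m$ matrices $L$ with unit diagonal and $L_{ij}=0$ for $i>j$, $(i,j)\notin E$. $\Theta_G=\{(L,D):L\in\mathcal{L}_G,\ D\text{ diagonal},\ D_{ii}>0\}$.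 The modified Cholesky decomposition of a positive definite $\Sigma$ is the unique $\Sigma=LDL^T$ with $L$ lower-triangular with unit diagonal and $D$ diagonal with positive entries. $V\in S_H$ means: (i) for every positive definite $\Sigma=LDL^T$ (modified Cholesky), $L\in\mathcal{L}_G\Leftrightarrow\Sigma\in P_G$; and (ii) for lower-triangular $L$ with unit diagonal, $L\in\mathcal{L}_G\Leftrightarrow L^{-1}\in\mathcal{L}_G$. The $\mathit{IW}_{Q_G}^{U,\alpha,\beta}$ distribution on $P_G$ has density (with respect to Lebesgue measure $\prod_{i}d\Sigma_{ii}\prod_{i>j,(i,j)\in E}d\Sigma_{ij}$) proportional to $$e^{-\operatorname{tr}(\Sigma^{-1}U)/2}\,\frac{\prod_{C\in\mathcal{C}}|(\Sigma^{-1})_C|^{\alpha(C)+(|C|+1)/2}}{\prod_{S\in\mathcal{S}}|(\Sigma^{-1})_S|^{\nu(S)(\beta(S)+(|S|+1)/2)}},$$ where $A_C$ is the principal submatrix indexed by $C$ and $|A_C|$ its determinant ($1$ if $C=\emptyset$). Let $z_G(U,\alpha')=\int_{\Theta_G}\exp(-\frac12\{\operatorname{tr}((LDL^T)^{-1}U)+\sum_i\alpha'_i\log D_{ii}\})\,dL\,dD$ with $dL\,dD=\prod_{(i,j)\in E,\,i>j}dL_{ij}\prod_i dD_{ii}$. When this is finite, $\pi_{U,\alpha'}$ is the probability distribution on $\Theta_G$ with density equal to this integrand divided by $z_G(U,\alpha')$, and $\pi^{P_G}_{U,\alpha'}$ is its image on $P_G$ under $(L,D)\mapsto LDL^T$.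 *)

theory Defs
  imports "HOL-Probability.Probability"
begin

text \<open>The vertex set \<open>{1,\<dots>,m}\<close> is the universe of a finite linearly ordered type
  \<open>'n\<close>, \<open>m = CARD('n)\<close>. A graph is its edge relation \<open>E :: ('n \<times> 'n) set\<close>.\<close>

definition undirected_graph :: "('n \<times> 'n) set \<Rightarrow> bool" where
  "undirected_graph E \<longleftrightarrow> sym E \<and> irrefl E"

definition closed_nbhd :: "('n \<times> 'n) set \<Rightarrow> 'n \<Rightarrow> 'n set" where
  "closed_nbhd E i = {i} \<union> {u. (u, i) \<in> E}"

definition homogeneous :: "('n \<times> 'n) set \<Rightarrow> bool" where
  "homogeneous E \<longleftrightarrow>
     (\<forall>(i, j) \<in> E. closed_nbhd E j \<subseteq> closed_nbhd E i \<or> closed_nbhd E i \<subseteq> closed_nbhd E j)"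

subsection \<open>Cliques, perfect orders, separators\<close>

definition complete_set :: "('n \<times> 'n) set \<Rightarrow> 'n set \<Rightarrow> bool" where
  "complete_set E C \<longleftrightarrow> (\<forall>i\<in>C. \<forall>j\<in>C. i \<noteq> j \<longrightarrow> (i, j) \<in> E)"

definition cliques :: "('n \<times> 'n) set \<Rightarrow> 'n set set" where
  "cliques E = {C. complete_set E C \<and> (\<forall>C'. complete_set E C' \<and> C \<subseteq> C' \<longrightarrow> C' = C)}"

text \<open>Lists are indexed from \<open>0\<close>, so separators exist for \<open>j = 1, \<dots>, k - 1\<close>.\<close>

definition separator :: "'n set list \<Rightarrow> nat \<Rightarrow> 'n set" where
  "separator Cs j = (\<Union>i<j. Cs ! i) \<inter> Cs ! j"

text \<open>Perfect means the running intersection property.\<close>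

definition perfect_order :: "('n \<times> 'n) set \<Rightarrow> 'n set list \<Rightarrow> bool" where
  "perfect_order E Cs \<longleftrightarrow> distinct Cs \<and> set Cs = cliques E \<and>
     (\<forall>j\<in>{1..<length Cs}. \<exists>i<j. separator Cs j \<subseteq> Cs ! i)"

definition separators :: "'n set list \<Rightarrow> 'n set set" where
  "separators Cs = separator Cs ` {1..<length Cs}"

definition sep_mult :: "'n set list \<Rightarrow> 'n set \<Rightarrow> nat" where
  "sep_mult Cs S = card {j \<in> {1..<length Cs}. separator Cs j = S}"

subsection \<open>Matrices\<close>

type_synonym 'n rvec = "real^'n"
type_synonym 'n sqmat = "real^'n^'n"

definition pos_def :: "'n::finite sqmat \<Rightarrow> bool" where
  "pos_def A \<longleftrightarrow> transpose A = A \<and> (\<forall>x. x \<noteq> 0 \<longrightarrow> x \<bullet> (A *v x) > 0)"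

definition P_G :: "('n \<times> 'n) set \<Rightarrow> 'n::finite sqmat set" where
  "P_G E = {A. pos_def A \<and> (\<forall>i j. i \<noteq> j \<and> (i, j) \<notin> E \<longrightarrow> A $ i $ j = 0)}"

definition unit_lower :: "'n::{finite,linorder} sqmat \<Rightarrow> bool" where
  "unit_lower L \<longleftrightarrow> (\<forall>i. L $ i $ i = 1) \<and> (\<forall>i j. i < j \<longrightarrow> L $ i $ j = 0)"

definition L_G :: "('n \<times> 'n) set \<Rightarrow> 'n::{finite,linorder} sqmat set" where
  "L_G E = {L. unit_lower L \<and> (\<forall>i j. i > j \<and> (i, j) \<notin> E \<longrightarrow> L $ i $ j = 0)}"

definition pos_diag :: "'n::finite sqmat \<Rightarrow> bool" where
  "pos_diag D \<longleftrightarrow> (\<forall>i j. i \<noteq> j \<longrightarrow> D $ i $ j = 0) \<and> (\<forall>i. D $ i $ i > 0)"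

definition Theta_G ::
    "('n \<times> 'n) set \<Rightarrow> ('n::{finite,linorder} sqmat \<times> 'n sqmat) set" where
  "Theta_G E = {(L, D). L \<in> L_G E \<and> pos_diag D}"

definition LDLt :: "'n::finite sqmat \<times> 'n sqmat \<Rightarrow> 'n sqmat" where
  "LDLt = (\<lambda>(L, D). L ** D ** transpose L)"

definition modified_cholesky ::
    "'n::{finite,linorder} sqmat \<Rightarrow> 'n sqmat \<Rightarrow> 'n sqmat \<Rightarrow> bool" where
  "modified_cholesky A L D \<longleftrightarrow> unit_lower L \<and> pos_diag D \<and> A = LDLt (L, D)"

text \<open>The condition \<open>V \<in> S\<^sub>H\<close> on the vertex order, that is, on the order of \<open>'n\<close>.\<close>

definition S_H :: "(('n::{finite,linorder}) \<times> 'n) set \<Rightarrow> bool" where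
  "S_H E \<longleftrightarrow>
     (\<forall>A L D. pos_def A \<and> modified_cholesky A L D \<longrightarrow> (L \<in> L_G E \<longleftrightarrow> A \<in> P_G E)) \<and>
     (\<forall>L. unit_lower L \<longrightarrow> (L \<in> L_G E \<longleftrightarrow> matrix_inv L \<in> L_G E))"

text \<open>The determinant of the principal submatrix indexed by \<open>C\<close>, by the Leibniz formula:
  the library's \<^term>\<open>det\<close> with \<^term>\<open>UNIV\<close> replaced by \<open>C\<close>.\<close>

definition principal_minor :: "'n::finite sqmat \<Rightarrow> 'n set \<Rightarrow> real" where
  "principal_minor A C = (\<Sum>p | p permutes C. of_int (sign p) * (\<Prod>i\<in>C. A $ i $ p i))"

lemma principal_minor_UNIV: "principal_minor A UNIV = det A"
  by (simp add: principal_minor_def det_def)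

lemma principal_minor_empty: "principal_minor A {} = 1"
  by (simp add: principal_minor_def)

subsection \<open>The distribution \<open>IW\<close>\<close>

text \<open>All measures live on the Borel sets of the ambient matrix space; densities carry the
  indicator of \<open>P\<^sub>G\<close> or \<open>\<Theta>\<^sub>G\<close>. A reference measure is the image of Lebesgue measure on the free
  coordinates under the map that fills in the matrix.\<close>

definition lower_edges :: "(('n::linorder) \<times> 'n) set \<Rightarrow> ('n \<times> 'n) set" where
  "lower_edges E = {(i, j) \<in> E. i > j}"

definition sym_of_coords ::
    "('n \<times> 'n) set \<Rightarrow> ('n \<times> 'n \<Rightarrow> real) \<Rightarrow> 'n::{finite,linorder} sqmat" where
  "sym_of_coords E x =
     (\<chi> i j. if i = j \<or> (i, j) \<in> E then x (max i j, min i j) else 0)"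

definition lebesgue_P_G :: "('n \<times> 'n) set \<Rightarrow> 'n::{finite,linorder} sqmat measure" where
  "lebesgue_P_G E =
     distr (PiM (Id \<union> lower_edges E) (\<lambda>_. lborel)) borel (sym_of_coords E)"

definition IW_kernel ::
    "('n \<times> 'n) set \<Rightarrow> 'n set list \<Rightarrow> 'n::finite sqmat \<Rightarrow> ('n set \<Rightarrow> real) \<Rightarrow> ('n set \<Rightarrow> real)
      \<Rightarrow> 'n sqmat \<Rightarrow> real" where
  "IW_kernel E Cs U \<alpha> \<beta> A =
     exp (- trace (matrix_inv A ** U) / 2)
     * (\<Prod>C\<in>cliques E. principal_minor (matrix_inv A) C powr (\<alpha> C + (real (card C) + 1) / 2))
     / (\<Prod>S\<in>separators Cs. principal_minor (matrix_inv A) S powr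
          (real (sep_mult Cs S) * (\<beta> S + (real (card S) + 1) / 2)))"

definition IW_const ::
    "('n \<times> 'n) set \<Rightarrow> 'n set list \<Rightarrow> 'n::{finite,linorder} sqmat
      \<Rightarrow> ('n set \<Rightarrow> real) \<Rightarrow> ('n set \<Rightarrow> real) \<Rightarrow> ennreal" where
  "IW_const E Cs U \<alpha> \<beta> =
     (\<integral>\<^sup>+A\<in>P_G E. ennreal (IW_kernel E Cs U \<alpha> \<beta> A) \<partial>lebesgue_P_G E)"

text \<open>Only finiteness is required: the kernel is positive on \<open>P\<^sub>G\<close>, a nonempty open subset of
  the coordinate space, so the integral is never \<open>0\<close>.\<close>

definition IW_normalizable ::
    "('n \<times> 'n) set \<Rightarrow> 'n set list \<Rightarrow> 'n::{finite,linorder} sqmat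
      \<Rightarrow> ('n set \<Rightarrow> real) \<Rightarrow> ('n set \<Rightarrow> real) \<Rightarrow> bool" where
  "IW_normalizable E Cs U \<alpha> \<beta> \<longleftrightarrow> IW_const E Cs U \<alpha> \<beta> < \<infinity>"

definition IW ::
    "('n \<times> 'n) set \<Rightarrow> 'n set list \<Rightarrow> 'n::{finite,linorder} sqmat
      \<Rightarrow> ('n set \<Rightarrow> real) \<Rightarrow> ('n set \<Rightarrow> real) \<Rightarrow> 'n sqmat measure" where
  "IW E Cs U \<alpha> \<beta> = density (lebesgue_P_G E)
     (\<lambda>A. ennreal (IW_kernel E Cs U \<alpha> \<beta> A) * indicator (P_G E) A / IW_const E Cs U \<alpha> \<beta>)"

subsection \<open>The distributions \<open>\<pi>\<close> and \<open>\<pi>\<^sup>P\<close>\<close>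

definition lower_of_coords ::
    "('n \<times> 'n) set \<Rightarrow> ('n \<times> 'n \<Rightarrow> real) \<Rightarrow> 'n::{finite,linorder} sqmat" where
  "lower_of_coords E x =
     (\<chi> i j. if i = j then 1 else if (i, j) \<in> lower_edges E then x (i, j) else 0)"

definition diag_of_coords :: "('n \<Rightarrow> real) \<Rightarrow> 'n::finite sqmat" where
  "diag_of_coords d = (\<chi> i j. if i = j then d i else 0)"

definition lebesgue_Theta_G ::
    "('n \<times> 'n) set \<Rightarrow> ('n::{finite,linorder} sqmat \<times> 'n sqmat) measure" where
  "lebesgue_Theta_G E =
     distr (PiM (lower_edges E) (\<lambda>_. lborel) \<Otimes>\<^sub>M PiM UNIV (\<lambda>_. lborel)) borel
       (\<lambda>(x, d). (lower_of_coords E x, diag_of_coords d))"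

definition pi_kernel ::
    "'n::finite sqmat \<Rightarrow> 'n rvec \<Rightarrow> 'n sqmat \<times> 'n sqmat \<Rightarrow> real" where
  "pi_kernel U \<alpha>' = (\<lambda>(L, D).
     exp (- (trace (matrix_inv (LDLt (L, D)) ** U) + (\<Sum>i\<in>UNIV. \<alpha>' $ i * ln (D $ i $ i))) / 2))"

definition z_G ::
    "('n \<times> 'n) set \<Rightarrow> 'n::{finite,linorder} sqmat \<Rightarrow> 'n rvec \<Rightarrow> ennreal" where
  "z_G E U \<alpha>' = (\<integral>\<^sup>+\<theta>\<in>Theta_G E. ennreal (pi_kernel U \<alpha>' \<theta>) \<partial>lebesgue_Theta_G E)"

definition pi_Theta ::
    "('n \<times> 'n) set \<Rightarrow> 'n::{finite,linorder} sqmat \<Rightarrow> 'n rvec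
      \<Rightarrow> ('n sqmat \<times> 'n sqmat) measure" where
  "pi_Theta E U \<alpha>' = density (lebesgue_Theta_G E)
     (\<lambda>\<theta>. ennreal (pi_kernel U \<alpha>' \<theta>) * indicator (Theta_G E) \<theta> / z_G E U \<alpha>')"

definition pi_P_G ::
    "('n \<times> 'n) set \<Rightarrow> 'n::{finite,linorder} sqmat \<Rightarrow> 'n rvec \<Rightarrow> 'n sqmat measure" where
  "pi_P_G E U \<alpha>' = distr (pi_Theta E U \<alpha>') borel LDLt"

end

theory Submission
  imports Defs
begin

text \<open>The two conditions in \<open>S\<^sub>H\<close> make every clique, and hence every separator, closed under
  passing to larger neighbours. As \<open>L\<inverse>\<close> is again in \<open>\<L>\<^sub>G\<close>, the block of
  \<open>(L D L\<^sup>T)\<inverse>\<close> on such a set \<open>C\<close> only involves the block of \<open>L\<inverse>\<close> on \<open>C\<close>, so its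
  determinant is \<open>\<Prod>i\<in>C. 1 / D\<^sub>i\<^sub>i\<close>. Taken column by column, \<open>(L, D) \<mapsto> L D L\<^sup>T\<close> is a
  triangular map, affine in each new coordinate, with Jacobian \<open>\<Prod>D\<^sub>j\<^sub>j\<close> over the edges \<open>(i, j)\<close>
  with \<open>i > j\<close>. The \<open>IW\<close> density thus pulls back to the kernel of \<open>\<pi>\<close> for an explicit \<open>\<alpha>'\<close>,
  which is positive because otherwise the integral over \<open>D\<^sub>i\<^sub>i\<close> diverges at infinity.\<close>

subsection \<open>Triangular matrices and principal minors\<close>

text \<open>The obstacle is fill-in: for a general order, \<open>L D L^T\<close> has nonzero entries
  outside \<open>E\<close>, and its entries no longer match the free coordinates of
  \<open>P_G E\<close>. For an order in \<open>S_H\<close> two larger neighbours of a vertex are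
  adjacent, which rules fill-in out. Such facts about the order are extracted by feeding 0-1
  matrices to the two conditions of \<open>S_H\<close>. The change of variables runs over the whole
  coordinate space, where \<open>D\<close> may have entries of any sign. There it reduces, up to a
  null set, to one-dimensional affine substitutions; positivity enters only afterwards, through the
  equivalence of \<open>L D L^T\<close> being in \<open>P_G E\<close> with \<open>(L, D)\<close>
  being in \<open>Theta_G E\<close>. The resulting identity keeps a free test function. Taking it
  constant identifies the two normalizing constants, so finiteness of \<open>z_G\<close> is
  inherited from normalizability, and the sign of \<alpha>' can be read off from that finiteness
  rather than from conditions on \<alpha> and \<beta>.\<close>

lemma matrix_inv_mult:
  fixes A :: "'a::semiring_1^'n^'n"
  assumes "invertible A"
  shows "A ** matrix_inv A = mat 1" "matrix_inv A ** A = mat 1"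
proof -
  have "A ** matrix_inv A = mat 1 \<and> matrix_inv A ** A = mat 1"
    unfolding matrix_inv_def by (rule someI_ex) (use assms in \<open>simp add: invertible_def\<close>)
  then show "A ** matrix_inv A = mat 1" "matrix_inv A ** A = mat 1" by auto
qed

lemma matrix_inv_unique:
  fixes A :: "'a::field^'n^'n"
  assumes "A ** B = mat 1"
  shows "matrix_inv A = B"
proof -
  have "B ** A = mat 1"
    using assms matrix_left_right_inverse by blast
  then have "invertible A"
    using assms by (auto simp: invertible_def)
  then have "matrix_inv A = matrix_inv A ** (A ** B)"
    using assms by simp
  also have "\<dots> = B"
    using matrix_inv_mult(2)[OF \<open>invertible A\<close>] by (simp add: matrix_mul_assoc)
  finally show ?thesis .
qed

text \<open>The least moved point would go to a strictly smaller, hence fixed, point, against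
  injectivity.\<close>

lemma permutes_le_imp_id:
  fixes p :: "'n::{finite,linorder} \<Rightarrow> 'n"
  assumes p: "p permutes S" and le: "\<And>i. p i \<le> i"
  shows "p = id"
proof (rule ccontr)
  assume "p \<noteq> id"
  then have "{i. p i \<noteq> i} \<noteq> {}"
    by (auto simp: fun_eq_iff)
  define i where "i = Min {i. p i \<noteq> i}"
  have i: "p i \<noteq> i"
    using Min_in[OF _ \<open>{i. p i \<noteq> i} \<noteq> {}\<close>] by (simp add: i_def)
  have "p (p i) = p i"
  proof (rule ccontr)
    assume "p (p i) \<noteq> p i"
    then have "i \<le> p i"
      unfolding i_def by (intro Min_le) auto
    with le[of i] i show False by simp
  qed
  then have "p i = i"
    using permutes_inj[OF p] by (meson injD)
  with i show False by simp
qed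

text \<open>The library's version needs the index type to be of class \<open>wellorder\<close>.\<close>

lemma det_lower_triangular:
  fixes A :: "'a::comm_ring_1^('n::{finite,linorder})^('n::{finite,linorder})"
  assumes "\<And>i j. i < j \<Longrightarrow> A $ i $ j = 0"
  shows "det A = (\<Prod>i\<in>UNIV. A $ i $ i)"
proof -
  have "det A = (\<Sum>p\<in>{id}. of_int (sign p) * (\<Prod>i\<in>UNIV. A $ i $ p i))"
    unfolding det_def
  proof (rule sum.mono_neutral_right)
    show "\<forall>p\<in>{p. p permutes UNIV} - {id}. of_int (sign p) * (\<Prod>i\<in>UNIV. A $ i $ p i) = 0"
    proof
      fix p :: "'n \<Rightarrow> 'n" assume p: "p \<in> {p. p permutes UNIV} - {id}"
      then obtain i where "\<not> p i \<le> i"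
        using permutes_le_imp_id by blast
      then have "A $ i $ p i = 0"
        using assms by simp
      then have "(\<Prod>i\<in>UNIV. A $ i $ p i) = 0"
        by (intro prod_zero) auto
      then show "of_int (sign p) * (\<Prod>i\<in>UNIV. A $ i $ p i) = 0" by simp
    qed
  qed (auto simp: permutes_id)
  then show ?thesis by simp
qed

text \<open>Padding the block with an identity makes the multiplicativity of \<open>det\<close>
  available for minors. A permutation that moves a point outside \<open>C\<close> meets an
  off-diagonal zero in that row.\<close>

lemma principal_minor_eq_det:
  "principal_minor A C =
    det (\<chi> i j. if i \<in> C \<and> j \<in> C then A $ i $ j else if i = j then 1 else 0)"
    (is "_ = det ?B")
proof -
  have "det ?B = (\<Sum>p | p permutes C. of_int (sign p) * (\<Prod>i\<in>UNIV. ?B $ i $ p i))"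
    unfolding det_def
  proof (rule sum.mono_neutral_right)
    show "{p. p permutes C} \<subseteq> {p. p permutes UNIV}"
      by (auto intro: permutes_subset)
    show "\<forall>p\<in>{p. p permutes UNIV} - {p. p permutes C}.
        of_int (sign p) * (\<Prod>i\<in>UNIV. ?B $ i $ p i) = 0"
    proof
      fix p :: "'a \<Rightarrow> 'a" assume p: "p \<in> {p. p permutes UNIV} - {p. p permutes C}"
      then have "bij p"
        using permutes_bij by blast
      with p obtain i where "i \<notin> C" "p i \<noteq> i"
        by (auto simp: permutes_def bij_iff)
      then have "?B $ i $ p i = 0" by auto
      then have "(\<Prod>i\<in>UNIV. ?B $ i $ p i) = 0"
        by (intro prod_zero bexI[of _ i]) auto
      then show "of_int (sign p) * (\<Prod>i\<in>UNIV. ?B $ i $ p i) = 0" by simp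
    qed
  qed simp
  also have "\<dots> = principal_minor A C"
    unfolding principal_minor_def
  proof (intro sum.cong refl)
    fix p assume "p \<in> {p. p permutes C}"
    then have p: "p permutes C" by simp
    have "(\<Prod>i\<in>UNIV. ?B $ i $ p i) = (\<Prod>i\<in>C. ?B $ i $ p i)"
      by (rule prod.mono_neutral_right) (use permutes_not_in[OF p] in auto)
    also have "\<dots> = (\<Prod>i\<in>C. A $ i $ p i)"
      by (rule prod.cong) (use permutes_in_image[OF p] in auto)
    finally show "of_int (sign p) * (\<Prod>i\<in>UNIV. ?B $ i $ p i)
        = of_int (sign p) * (\<Prod>i\<in>C. A $ i $ p i)" by simp
  qed
  finally show ?thesis by simp
qed

text \<open>The columns of \<open>M\<close> with index in \<open>C\<close> are supported in
  \<open>C\<close>, so the sum for an entry of the block only meets indices in \<open>C\<close>. The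
  block therefore factors as transposed block of \<open>M\<close>, diagonal block, block of
  \<open>M\<close>, and the outer two have determinant 1.\<close>

lemma principal_minor_closed_set:
  fixes M :: "'n::{finite,linorder} sqmat"
  assumes M: "unit_lower M" and closed: "\<And>a k. a \<in> C \<Longrightarrow> M $ k $ a \<noteq> 0 \<Longrightarrow> k \<in> C"
    and A: "\<And>a b. A $ a $ b = (\<Sum>k\<in>UNIV. M $ k $ a * d k * M $ k $ b)"
  shows "principal_minor A C = (\<Prod>i\<in>C. d i)"
proof -
  define M' :: "'n sqmat"
    where "M' = (\<chi> i j. if i \<in> C \<and> j \<in> C then M $ i $ j else if i = j then 1 else 0)"
  define D' :: "'n sqmat"
    where "D' = (\<chi> i j. if i = j then (if i \<in> C then d i else 1) else 0)"
  have "(\<chi> i j. if i \<in> C \<and> j \<in> C then A $ i $ j else if i = j then 1 else 0)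
      = transpose M' ** (D' ** M')"
  proof (intro vec_eq_iff[THEN iffD2] allI)
    fix a b
    have D'M': "(D' ** M') $ k $ b = (if k \<in> C then d k else 1) * M' $ k $ b" for k
    proof -
      have "(D' ** M') $ k $ b = (\<Sum>l\<in>UNIV. if l = k then (if k \<in> C then d k else 1) * M' $ l $ b else 0)"
        unfolding matrix_matrix_mult_def D'_def vec_lambda_beta by (intro sum.cong) auto
      then show ?thesis by simp
    qed
    have *: "(transpose M' ** (D' ** M')) $ a $ b
        = (\<Sum>k\<in>UNIV. M' $ k $ a * ((if k \<in> C then d k else 1) * M' $ k $ b))"
      unfolding matrix_matrix_mult_def[of "transpose M'"] by (simp add: D'M' transpose_def)
    show "(\<chi> i j. if i \<in> C \<and> j \<in> C then A $ i $ j else if i = j then 1 else 0) $ a $ b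
        = (transpose M' ** (D' ** M')) $ a $ b"
    proof (cases "a \<in> C \<and> b \<in> C")
      case True
      then have "M' $ k $ a * ((if k \<in> C then d k else 1) * M' $ k $ b)
          = M $ k $ a * d k * M $ k $ b" for k
        using closed[of a k] by (auto simp: M'_def)
      then have "(transpose M' ** (D' ** M')) $ a $ b = A $ a $ b"
        unfolding * A by (intro sum.cong refl)
      with True show ?thesis by simp
    next
      case False
      have "M' $ k $ a * ((if k \<in> C then d k else 1) * M' $ k $ b)
          = (if k = a then (if a = b then 1 else 0) else 0)" for k
        using False
        by (cases "k = a"; cases "k = b"; cases "a \<in> C"; cases "b \<in> C"; cases "k \<in> C")
          (simp_all add: M'_def)
      then have "(transpose M' ** (D' ** M')) $ a $ b
          = (\<Sum>k\<in>UNIV. if k = a then (if a = b then 1 else 0) else 0)"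
        unfolding * by (intro sum.cong refl)
      with False show ?thesis by auto
    qed
  qed
  then have "principal_minor A C = det M' * (det D' * det M')"
    by (simp add: principal_minor_eq_det det_mul)
  moreover have "det M' = 1"
    by (subst det_lower_triangular) (use M in \<open>auto simp: M'_def unit_lower_def intro!: prod.neutral\<close>)
  moreover have "det D' = (\<Prod>i\<in>UNIV. if i \<in> C then d i else 1)"
    by (subst det_diagonal) (auto simp: D'_def)
  moreover have "\<dots> = (\<Prod>i\<in>C. d i)"
    by (simp add: prod.If_cases)
  ultimately show ?thesis by simp
qed

lemma unit_lower_invertible:
  assumes "unit_lower (L :: 'n::{finite,linorder} sqmat)"
  shows "invertible L"
proof -
  have "det L = 1"
    by (subst det_lower_triangular) (use assms in \<open>auto simp: unit_lower_def\<close>)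
  then show ?thesis by (simp add: invertible_det_nz)
qed

section \<open>Entries, definiteness and inverse of \<open>L D L^T\<close>\<close>

lemma LDLt_nth:
  assumes "\<forall>i j. i \<noteq> j \<longrightarrow> D $ i $ j = 0"
  shows "LDLt (L, D) $ i $ j = (\<Sum>k\<in>UNIV. L $ i $ k * D $ k $ k * L $ j $ k)"
proof -
  have "(\<Sum>l\<in>UNIV. L $ i $ l * D $ l $ k) = (\<Sum>l\<in>UNIV. if l = k then L $ i $ k * D $ k $ k else 0)" for k
    by (intro sum.cong) (use assms in auto)
  then show ?thesis
    by (simp add: LDLt_def matrix_matrix_mult_def transpose_def)
qed

lemma LDLt_symmetric:
  assumes "\<forall>i j. i \<noteq> j \<longrightarrow> D $ i $ j = 0"
  shows "transpose (LDLt (L, D)) = LDLt (L, D)"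
  by (simp add: vec_eq_iff transpose_def LDLt_nth[OF assms] mult_ac)

lemma inner_LDLt:
  assumes "\<forall>i j. i \<noteq> j \<longrightarrow> D $ i $ j = 0"
  shows "x \<bullet> (LDLt (L, D) *v x) = (\<Sum>k\<in>UNIV. D $ k $ k * ((transpose L *v x) $ k)\<^sup>2)"
proof -
  have D: "(D *v y) $ k = D $ k $ k * y $ k" for y k
  proof -
    have "(D *v y) $ k = (\<Sum>j\<in>UNIV. if j = k then D $ k $ k * y $ k else 0)"
      unfolding matrix_vector_mult_def vec_lambda_beta by (intro sum.cong) (use assms in auto)
    then show ?thesis by simp
  qed
  have "x \<bullet> (LDLt (L, D) *v x) = x \<bullet> (L *v (D *v (transpose L *v x)))"
    by (simp add: LDLt_def matrix_vector_mul_assoc matrix_mul_assoc del: transpose_matrix_vector)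
  also have "\<dots> = (transpose L *v x) \<bullet> (D *v (transpose L *v x))"
    by (simp add: dot_lmul_matrix)
  also have "\<dots> = (\<Sum>k\<in>UNIV. D $ k $ k * ((transpose L *v x) $ k)\<^sup>2)"
    by (simp add: inner_vec_def D power2_eq_square mult_ac del: transpose_matrix_vector)
  finally show ?thesis .
qed

text \<open>The invertible substitution \<open>y = transpose L *v x\<close> diagonalizes the
  quadratic form, and the \<open>x\<close> with \<open>y = axis i 1\<close> isolates
  \<open>D $ i $ i\<close>. The signs of the diagonal are left open so that the equivalence can be
  used at arbitrary coordinate points.\<close>

lemma pos_def_LDLt_iff:
  fixes L :: "'n::{finite,linorder} sqmat"
  assumes L: "unit_lower L" and D: "\<forall>i j. i \<noteq> j \<longrightarrow> D $ i $ j = 0"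
  shows "pos_def (LDLt (L, D)) \<longleftrightarrow> pos_diag D"
proof
  have inv: "invertible (transpose L)"
    using unit_lower_invertible[OF L] by (rule transpose_invertible)
  show "pos_diag D" if pd: "pos_def (LDLt (L, D))"
    unfolding pos_diag_def
  proof (intro conjI allI)
    show "\<And>i j. i \<noteq> j \<longrightarrow> D $ i $ j = 0" using D by blast
    fix i
    define x where "x = matrix_inv (transpose L) *v axis i 1"
    have Lx: "transpose L *v x = axis i 1"
      unfolding x_def matrix_vector_mul_assoc matrix_inv_mult[OF inv] by simp
    have "x \<noteq> 0"
      using Lx by (metis axis_eq_0_iff matrix_vector_mult_0_right zero_neq_one)
    then have "0 < x \<bullet> (LDLt (L, D) *v x)"
      using pd by (simp add: pos_def_def)
    also have "\<dots> = (\<Sum>k\<in>UNIV. D $ k $ k * ((axis i 1 :: 'n rvec) $ k)\<^sup>2)"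
      unfolding inner_LDLt[OF D] Lx ..
    also have "\<dots> = (\<Sum>k\<in>UNIV. if k = i then D $ k $ k else 0)"
      by (intro sum.cong) (auto simp: axis_def)
    finally show "0 < D $ i $ i" by simp
  qed
  show "pos_def (LDLt (L, D))" if "pos_diag D"
    unfolding pos_def_def
  proof (intro conjI allI impI LDLt_symmetric[OF D])
    fix x :: "'n rvec" assume "x \<noteq> 0"
    have "transpose L *v x \<noteq> 0"
    proof
      assume "transpose L *v x = 0"
      then have "(matrix_inv (transpose L) ** transpose L) *v x = 0"
        by (metis matrix_vector_mul_assoc matrix_vector_mult_0_right)
      with \<open>x \<noteq> 0\<close> show False
        by (simp add: matrix_inv_mult[OF inv])
    qed
    then obtain i where "(transpose L *v x) $ i \<noteq> 0"
      by (metis vec_eq_iff zero_index)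
    with that have "0 < D $ i $ i * ((transpose L *v x) $ i)\<^sup>2"
      unfolding pos_diag_def by (metis mult_pos_pos zero_less_power2)
    also have "\<dots> \<le> (\<Sum>k\<in>UNIV. D $ k $ k * ((transpose L *v x) $ k)\<^sup>2)"
      using that
      by (intro member_le_sum[of i UNIV "\<lambda>k. D $ k $ k * ((transpose L *v x) $ k)\<^sup>2"])
        (auto simp: pos_diag_def less_imp_le)
    finally show "0 < x \<bullet> (LDLt (L, D) *v x)"
      by (simp add: inner_LDLt[OF D])
  qed
qed

lemma matrix_inv_LDLt_nth:
  fixes L :: "'n::{finite,linorder} sqmat"
  assumes L: "unit_lower L" and D: "pos_diag D"
  shows "matrix_inv (LDLt (L, D)) $ a $ b
    = (\<Sum>k\<in>UNIV. matrix_inv L $ k $ a * (1 / D $ k $ k) * matrix_inv L $ k $ b)"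
proof -
  define D' :: "'n sqmat" where "D' = (\<chi> i j. if i = j then 1 / D $ i $ i else 0)"
  define M where "M = matrix_inv L"
  have off: "\<forall>i j. i \<noteq> j \<longrightarrow> D' $ i $ j = 0"
    by (simp add: D'_def)
  have DD': "D ** D' = mat 1"
  proof (intro vec_eq_iff[THEN iffD2] allI)
    fix i j
    have "(D ** D') $ i $ j = (\<Sum>k\<in>UNIV. if k = i then (if i = j then 1 else 0) else 0)"
      unfolding matrix_matrix_mult_def vec_lambda_beta
      by (intro sum.cong) (use D in \<open>auto simp: pos_diag_def D'_def\<close>, metis less_irrefl)
    then show "(D ** D') $ i $ j = mat 1 $ i $ j" by (simp add: mat_def)
  qed
  have LM: "L ** M = mat 1" "M ** L = mat 1"
    using matrix_inv_mult[OF unit_lower_invertible[OF L]] by (simp_all add: M_def)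
  have LM': "transpose L ** transpose M = mat 1"
    by (metis LM(2) matrix_transpose_mul transpose_mat)
  \<comment> \<open>The inverse is \<open>transpose M ** D' ** M\<close>, itself a value of
    \<open>LDLt\<close>, so \<open>LDLt_nth\<close> also gives its entries.\<close>
  have "LDLt (L, D) ** LDLt (transpose M, D')
      = L ** (D ** ((transpose L ** transpose M) ** D')) ** M"
    by (simp add: LDLt_def matrix_mul_assoc)
  also have "\<dots> = mat 1"
    by (simp add: LM' DD' LM)
  finally have "matrix_inv (LDLt (L, D)) = LDLt (transpose M, D')"
    by (rule matrix_inv_unique)
  then show ?thesis
    by (simp add: LDLt_nth[OF off] M_def transpose_def) (simp add: D'_def)
qed

text \<open>Grouping by \<open>k\<close> separates the variables: each \<open>D $ k $ k\<close>
  occurs in one summand only, over a numerator depending on \<open>L\<close> and \<open>U\<close>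
  alone. The divergence argument for \<open>z_G\<close> relies on this.\<close>

lemma trace_inv_LDLt:
  fixes L :: "'n::{finite,linorder} sqmat"
  assumes "unit_lower L" "pos_diag D"
  shows "trace (matrix_inv (LDLt (L, D)) ** U)
    = (\<Sum>k\<in>UNIV. (\<Sum>a\<in>UNIV. \<Sum>b\<in>UNIV. matrix_inv L $ k $ a * matrix_inv L $ k $ b * U $ b $ a)
        / D $ k $ k)"
proof -
  have "trace (matrix_inv (LDLt (L, D)) ** U) = (\<Sum>a\<in>UNIV. \<Sum>b\<in>UNIV. \<Sum>k\<in>UNIV.
      matrix_inv L $ k $ a * matrix_inv L $ k $ b * U $ b $ a / D $ k $ k)"
    by (simp add: trace_def matrix_matrix_mult_def matrix_inv_LDLt_nth[OF assms] sum_distrib_right)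
  also have "\<dots> = (\<Sum>k\<in>UNIV. \<Sum>a\<in>UNIV. \<Sum>b\<in>UNIV.
      matrix_inv L $ k $ a * matrix_inv L $ k $ b * U $ b $ a / D $ k $ k)"
    by (subst sum.swap, subst (2) sum.swap, subst sum.swap) (auto intro!: sum.cong sum.swap)
  finally show ?thesis
    by (simp add: sum_divide_distrib)
qed

subsection \<open>Vertex orders in \<open>S\<^sub>H\<close>\<close>

text \<open>With ones at \<open>(i, k)\<close> and \<open>(j, k)\<close> below the unit diagonal,
  \<open>L L^T\<close> has the entry 1 at \<open>(i, j)\<close>. The first condition of
  \<open>S_H\<close> puts this matrix into \<open>P_G E\<close>, which forces the edge.\<close>

lemma S_H_upper_nbrs_adjacent:
  fixes E :: "('n::{finite,linorder} \<times> 'n) set"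
  assumes "S_H E" and "k < j" "j < i" "(i, k) \<in> E" "(j, k) \<in> E"
  shows "(i, j) \<in> E"
proof (rule ccontr)
  assume nE: "(i, j) \<notin> E"
  define L :: "'n sqmat"
    where "L = (\<chi> a b. if a = b then 1 else if b = k \<and> (a = i \<or> a = j) then 1 else 0)"
  have L: "L \<in> L_G E" "unit_lower L"
    using assms by (auto simp: L_G_def unit_lower_def L_def)
  have D: "pos_diag (mat 1 :: 'n sqmat)"
    by (simp add: pos_diag_def mat_def)
  then have off: "\<forall>a b. a \<noteq> b \<longrightarrow> (mat 1 :: 'n sqmat) $ a $ b = 0"
    by (simp add: pos_diag_def)
  have "modified_cholesky (LDLt (L, mat 1)) L (mat 1)"
    using L D by (simp add: modified_cholesky_def)
  moreover have "pos_def (LDLt (L, mat 1))"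
    using pos_def_LDLt_iff[OF L(2) off] D by simp
  ultimately have "LDLt (L, mat 1) \<in> P_G E"
    using \<open>S_H E\<close> L by (auto simp: S_H_def)
  then have "LDLt (L, mat 1) $ i $ j = 0"
    using nE assms by (auto simp: P_G_def)
  moreover have "LDLt (L, mat 1) $ i $ j = (\<Sum>l\<in>UNIV. if l = k then 1 else 0)"
    unfolding LDLt_nth[OF off] using assms by (intro sum.cong) (auto simp: L_def mat_def)
  ultimately show False by simp
qed

text \<open>With ones at \<open>(i, k)\<close> and \<open>(k, j)\<close>, the inverse of
  \<open>L\<close> acquires the entry \<open>(-1) * (-1) = 1\<close> at \<open>(i, j)\<close>. The
  second condition of \<open>S_H\<close> keeps the inverse in \<open>L_G E\<close>.\<close>

lemma S_H_descending_path_adjacent: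
  fixes E :: "('n::{finite,linorder} \<times> 'n) set"
  assumes "S_H E" and "j < k" "k < i" "(i, k) \<in> E" "(k, j) \<in> E"
  shows "(i, j) \<in> E"
proof (rule ccontr)
  assume nE: "(i, j) \<notin> E"
  define L :: "'n sqmat" where
    "L = (\<chi> a b. if a = b then 1 else if a = i \<and> b = k then 1 else if a = k \<and> b = j then 1 else 0)"
  define M :: "'n sqmat" where
    "M = (\<chi> a b. if a = b then 1 else if a = i \<and> b = k then -1 else if a = k \<and> b = j then -1
        else if a = i \<and> b = j then 1 else 0)"
  have L: "L \<in> L_G E" "unit_lower L"
    using assms by (auto simp: L_G_def unit_lower_def L_def)
  have "L ** M = mat 1"
  proof (intro vec_eq_iff[THEN iffD2] allI)
    fix a b
    have ne: "i \<noteq> k" "k \<noteq> j" "i \<noteq> j"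
      using assms by auto
    \<comment> \<open>Row \<open>a\<close> of \<open>L\<close> is supported on \<open>a\<close>, on
      \<open>k\<close> if \<open>a = i\<close>, and on \<open>j\<close> if \<open>a = k\<close>: one
      summand for each.\<close>
    have "(L ** M) $ a $ b = (\<Sum>l\<in>UNIV. (if l = a then M $ a $ b else 0)
        + (if l = k then (if a = i then M $ k $ b else 0) else 0)
        + (if l = j then (if a = k then M $ j $ b else 0) else 0))"
      unfolding matrix_matrix_mult_def vec_lambda_beta
    proof (intro sum.cong refl)
      fix l
      show "L $ a $ l * M $ l $ b = (if l = a then M $ a $ b else 0)
        + (if l = k then (if a = i then M $ k $ b else 0) else 0)
        + (if l = j then (if a = k then M $ j $ b else 0) else 0)"
        using ne by (cases "l = a"; cases "l = k"; cases "l = j"; cases "a = i"; cases "a = k")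
          (simp_all add: L_def)
    qed
    also have "\<dots> = M $ a $ b + (if a = i then M $ k $ b else 0) + (if a = k then M $ j $ b else 0)"
      by (simp add: sum.distrib)
    also have "\<dots> = mat 1 $ a $ b"
      using ne by (cases "a = i"; cases "a = k"; cases "b = a"; cases "b = k"; cases "b = j")
        (simp_all add: M_def mat_def)
    finally show "(L ** M) $ a $ b = mat 1 $ a $ b" .
  qed
  then have "matrix_inv L = M"
    by (rule matrix_inv_unique)
  then have "M \<in> L_G E"
    using \<open>S_H E\<close> L by (auto simp: S_H_def)
  then have "M $ i $ j = 0"
    using nE assms by (auto simp: L_G_def)
  moreover have "M $ i $ j = 1"
    using assms(2,3) by (auto simp: M_def)
  ultimately show False by simp
qed

text \<open>A neighbour \<open>u\<close> of \<open>a\<close> below \<open>a\<close> completes the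
  descending path \<open>i\<close>, \<open>a\<close>, \<open>u\<close>; one above \<open>a\<close>
  is, like \<open>i\<close>, an upper neighbour of \<open>a\<close>. Either way \<open>u\<close> is
  adjacent to \<open>i\<close> or equal to it.\<close>

lemma S_H_closed_nbhd_mono:
  fixes E :: "('n::{finite,linorder} \<times> 'n) set"
  assumes "undirected_graph E" "S_H E" and ai: "(i, a) \<in> E" "a < i"
  shows "closed_nbhd E a \<subseteq> closed_nbhd E i"
proof
  have sym: "(y, x) \<in> E" if "(x, y) \<in> E" for x y
    using assms(1) that by (auto simp: undirected_graph_def sym_def)
  fix u assume "u \<in> closed_nbhd E a"
  then consider "u = a" | "(u, a) \<in> E" "u = i" | "(u, a) \<in> E" "u < a"
    | "(u, a) \<in> E" "a < u" "u < i" | "(u, a) \<in> E" "a < u" "i < u"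
    using assms(1) by (cases u a rule: linorder_cases; cases u i rule: linorder_cases)
      (auto simp: closed_nbhd_def undirected_graph_def irrefl_def)
  then show "u \<in> closed_nbhd E i"
  proof cases
    case 3
    then show ?thesis
      using S_H_descending_path_adjacent[OF \<open>S_H E\<close>, of u a i] ai sym by (auto simp: closed_nbhd_def)
  next
    case 4
    then show ?thesis
      using S_H_upper_nbrs_adjacent[OF \<open>S_H E\<close>, of a u i] ai sym by (auto simp: closed_nbhd_def)
  next
    case 5
    then show ?thesis
      using S_H_upper_nbrs_adjacent[OF \<open>S_H E\<close>, of a i u] ai sym by (auto simp: closed_nbhd_def)
  qed (use ai sym in \<open>auto simp: closed_nbhd_def\<close>)
qed

definition up_closed :: "(('n::linorder) \<times> 'n) set \<Rightarrow> 'n set \<Rightarrow> bool" where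
  "up_closed E C \<longleftrightarrow> (\<forall>a\<in>C. \<forall>i. a < i \<and> (i, a) \<in> E \<longrightarrow> i \<in> C)"

text \<open>For \<open>a\<close> in \<open>C\<close> with larger neighbour \<open>i\<close>, the
  clique lies in the closed neighbourhood of \<open>a\<close>, hence in that of \<open>i\<close>. So
  \<open>insert i C\<close> is complete, and maximality gives \<open>i\<close> in
  \<open>C\<close>.\<close>

lemma clique_up_closed:
  fixes E :: "('n::{finite,linorder} \<times> 'n) set"
  assumes G: "undirected_graph E" "S_H E" and C: "C \<in> cliques E"
  shows "up_closed E C"
  unfolding up_closed_def
proof (intro ballI allI impI)
  fix a i assume a: "a \<in> C" and i: "a < i \<and> (i, a) \<in> E"
  have sym: "(y, x) \<in> E" if "(x, y) \<in> E" for x y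
    using G(1) that by (auto simp: undirected_graph_def sym_def)
  have "C \<subseteq> closed_nbhd E a"
    using C a by (auto simp: cliques_def complete_set_def closed_nbhd_def)
  also have "\<dots> \<subseteq> closed_nbhd E i"
    using S_H_closed_nbhd_mono[OF G] i by blast
  finally have "complete_set E (insert i C)"
    using C sym by (auto simp: cliques_def complete_set_def closed_nbhd_def)
  then show "i \<in> C"
    using C by (auto simp: cliques_def)
qed

text \<open>Closure under larger neighbours survives unions and intersections, and a separator is
  built from cliques by these.\<close>

lemma separator_up_closed:
  fixes E :: "('n::{finite,linorder} \<times> 'n) set"
  assumes G: "undirected_graph E" "S_H E" and po: "perfect_order E Cs" and S: "S \<in> separators Cs"
  shows "up_closed E S"
proof -
  have "up_closed E (Cs ! i)" if "i < length Cs" for i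
    using clique_up_closed[OF G] po that by (metis nth_mem perfect_order_def)
  then have up: "i \<in> Cs ! l" if "l < length Cs" "a \<in> Cs ! l" "a < i" "(i, a) \<in> E" for l a i
    using that unfolding up_closed_def by blast
  from S obtain j where j: "j < length Cs" and S: "S = (\<Union>l<j. Cs ! l) \<inter> Cs ! j"
    by (auto simp: separators_def separator_def)
  show ?thesis
    unfolding up_closed_def
  proof (intro ballI allI impI)
    fix a i assume a: "a \<in> S" and i: "a < i \<and> (i, a) \<in> E"
    then obtain l where l: "l < j" "a \<in> Cs ! l"
      by (auto simp: S)
    then have "i \<in> Cs ! l" "i \<in> Cs ! j"
      using up a i j by (auto simp: S)
    with l(1) show "i \<in> S"
      by (auto simp: S)
  qed
qed

lemma principal_minor_inv_LDLt:
  fixes E :: "('n::{finite,linorder} \<times> 'n) set"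
  assumes "S_H E" "L \<in> L_G E" "pos_diag D" and C: "up_closed E C"
  shows "principal_minor (matrix_inv (LDLt (L, D))) C = (\<Prod>i\<in>C. 1 / D $ i $ i)"
proof (rule principal_minor_closed_set[where M = "matrix_inv L"])
  have L: "unit_lower L"
    using assms by (simp add: L_G_def)
  then have M: "matrix_inv L \<in> L_G E"
    using assms by (auto simp: S_H_def)
  then show "unit_lower (matrix_inv L)"
    by (simp add: L_G_def)
  show "k \<in> C" if "a \<in> C" "matrix_inv L $ k $ a \<noteq> 0" for a k
  proof (cases k a rule: linorder_cases)
    case less
    with that M show ?thesis by (simp add: L_G_def unit_lower_def)
  next
    case greater
    with that M have "(k, a) \<in> E"
      unfolding L_G_def by blast
    with greater that C show ?thesis
      unfolding up_closed_def by blast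
  qed (use that in simp)
qed (use assms in \<open>simp add: matrix_inv_LDLt_nth L_G_def\<close>)

text \<open>This makes the indicators of \<open>P_G E\<close> and \<open>Theta_G E\<close> agree at
  every coordinate point, including those with nonpositive diagonal entries.\<close>

lemma LDLt_in_P_G_iff:
  fixes E :: "('n::{finite,linorder} \<times> 'n) set"
  assumes "S_H E" "L \<in> L_G E" and D: "\<forall>i j. i \<noteq> j \<longrightarrow> D $ i $ j = 0"
  shows "LDLt (L, D) \<in> P_G E \<longleftrightarrow> (L, D) \<in> Theta_G E"
proof -
  have L: "unit_lower L"
    using assms by (simp add: L_G_def)
  have "LDLt (L, D) \<in> P_G E" if "pos_diag D"
    using assms that L pos_def_LDLt_iff[OF L D] by (auto simp: S_H_def modified_cholesky_def)
  moreover have "pos_diag D" if "LDLt (L, D) \<in> P_G E"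
    using that pos_def_LDLt_iff[OF L D] by (simp add: P_G_def)
  ultimately show ?thesis
    using assms by (auto simp: Theta_G_def)
qed

subsection \<open>Triangular changes of variables\<close>

text \<open>Fubini isolates coordinate \<open>n\<close>. Since \<open>a\<close> and \<open>b\<close>
  ignore it, they are constants in the inner integral, where the claim is the affine substitution on
  the real line.\<close>

lemma nn_integral_PiM_affine_coordinate:
  fixes a b :: "('i \<Rightarrow> real) \<Rightarrow> real"
  assumes I: "finite I" "n \<in> I"
    and [measurable]: "a \<in> borel_measurable (PiM I (\<lambda>_. lborel))"
      "b \<in> borel_measurable (PiM I (\<lambda>_. lborel))" "f \<in> borel_measurable (PiM I (\<lambda>_. lborel))"
    and indep: "\<And>x y. a (x(n := y)) = a x" "\<And>x y. b (x(n := y)) = b x"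
    and nz: "\<And>x. a x \<noteq> 0"
  shows "(\<integral>\<^sup>+x. f (x(n := b x + a x * x n)) * ennreal \<bar>a x\<bar> \<partial>PiM I (\<lambda>_. lborel))
    = (\<integral>\<^sup>+x. f x \<partial>PiM I (\<lambda>_. lborel))"
proof -
  interpret product_sigma_finite "\<lambda>_::'i. lborel :: real measure" by standard
  define J where "J = I - {n}"
  have IJ: "I = insert n J" "n \<notin> J" "finite J"
    using I by (auto simp: J_def)
  have [measurable]: "(\<lambda>x. x(n := b x + a x * x n)) \<in> PiM I (\<lambda>_. lborel) \<rightarrow>\<^sub>M PiM I (\<lambda>_. lborel)"
    by (rule measurable_fun_upd[where J = I]) (use I in auto)
  have "(\<integral>\<^sup>+x. f (x(n := b x + a x * x n)) * ennreal \<bar>a x\<bar> \<partial>PiM I (\<lambda>_. lborel))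
      = (\<integral>\<^sup>+x. \<integral>\<^sup>+y. f (x(n := b x + a x * y)) * ennreal \<bar>a x\<bar> \<partial>lborel \<partial>PiM J (\<lambda>_. lborel))"
    unfolding IJ(1)
    by (subst product_nn_integral_insert) (use IJ in \<open>simp_all add: indep flip: IJ(1)\<close>)
  also have "\<dots> = (\<integral>\<^sup>+x. \<integral>\<^sup>+y. f (x(n := y)) \<partial>lborel \<partial>PiM J (\<lambda>_. lborel))"
  proof (rule nn_integral_cong)
    fix x :: "'i \<Rightarrow> real" assume x: "x \<in> space (PiM J (\<lambda>_. lborel))"
    have "(\<lambda>y. x(n := y)) \<in> borel \<rightarrow>\<^sub>M PiM I (\<lambda>_. lborel)"
      by (rule measurable_fun_upd[where J = J]) (use IJ x in auto)
    then have [measurable]: "(\<lambda>y. f (x(n := y))) \<in> borel_measurable borel"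
      by measurable
    have [measurable]: "(\<lambda>y. f (x(n := b x + a x * y))) \<in> borel_measurable borel"
      using measurable_compose[OF _ \<open>(\<lambda>y. f (x(n := y))) \<in> borel_measurable borel\<close>,
        of "\<lambda>y. b x + a x * y" borel] by simp
    show "(\<integral>\<^sup>+y. f (x(n := b x + a x * y)) * ennreal \<bar>a x\<bar> \<partial>lborel)
        = (\<integral>\<^sup>+y. f (x(n := y)) \<partial>lborel)"
      by (subst (2) nn_integral_real_affine[OF _ nz[of x], where t = "b x"])
        (simp_all add: nn_integral_multc mult.commute[of "ennreal _"])
  qed
  also have "\<dots> = (\<integral>\<^sup>+x. f x \<partial>PiM I (\<lambda>_. lborel))"
    unfolding IJ(1) by (subst product_nn_integral_insert) (use IJ in \<open>simp_all flip: IJ(1)\<close>)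
  finally show ?thesis .
qed

text \<open>The coordinates are updated one at a time in order of decreasing rank, so that the
  coefficients of each update are still evaluated at the original point.\<close>

lemma nn_integral_PiM_triangular:
  fixes a b :: "'i \<Rightarrow> ('i \<Rightarrow> real) \<Rightarrow> real" and r :: "'i \<Rightarrow> int"
  assumes I: "finite I"
    and meas: "\<And>n. n \<in> I \<Longrightarrow> a n \<in> borel_measurable (PiM I (\<lambda>_. lborel))"
      "\<And>n. n \<in> I \<Longrightarrow> b n \<in> borel_measurable (PiM I (\<lambda>_. lborel))"
    and f: "f \<in> borel_measurable (PiM I (\<lambda>_. lborel))"
    and dep: "\<And>n x y. n \<in> I \<Longrightarrow> (\<And>m. m \<in> I \<Longrightarrow> r m < r n \<Longrightarrow> x m = y m) \<Longrightarrow>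
      a n x = a n y \<and> b n x = b n y"
    and nz: "\<And>n x. n \<in> I \<Longrightarrow> a n x \<noteq> 0"
  shows "(\<integral>\<^sup>+x. f (\<lambda>n\<in>I. b n x + a n x * x n) * (\<Prod>n\<in>I. ennreal \<bar>a n x\<bar>) \<partial>PiM I (\<lambda>_. lborel))
    = (\<integral>\<^sup>+x. f x \<partial>PiM I (\<lambda>_. lborel))"
proof -
  define P where "P S x = (\<lambda>n. if n \<in> S then b n x + a n x * x n else x n)" for S x
  have "finite S \<Longrightarrow> S \<subseteq> I \<Longrightarrow> f \<in> borel_measurable (PiM I (\<lambda>_. lborel)) \<Longrightarrow>
      (\<integral>\<^sup>+x. f (P S x) * (\<Prod>n\<in>S. ennreal \<bar>a n x\<bar>) \<partial>PiM I (\<lambda>_. lborel))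
        = (\<integral>\<^sup>+x. f x \<partial>PiM I (\<lambda>_. lborel))" for S f
  proof (induction S arbitrary: f rule: finite_ranking_induct[where f = "\<lambda>n. - r n"])
    case empty
    then show ?case by (simp add: P_def)
  next
    case (insert n S)
    show ?case
    proof (cases "n \<in> S")
      case True
      then show ?thesis using insert by (simp add: insert_absorb)
    next
      case False
      have n: "n \<in> I" and S: "S \<subseteq> I" using insert.prems by auto
      note [measurable] = meas[OF n] insert.prems(2)
      \<comment> \<open>The update of \<open>n\<close> is absorbed into the integrand; the induction
        hypothesis, general in \<open>f\<close>, then removes the updates of \<open>S\<close>, and a
        one-coordinate substitution removes the last one.\<close>
      define g where "g x = f (x(n := b n x + a n x * x n)) * ennreal \<bar>a n x\<bar>" for x
      have [measurable]:
        "(\<lambda>x. x(n := b n x + a n x * x n)) \<in> PiM I (\<lambda>_. lborel) \<rightarrow>\<^sub>M PiM I (\<lambda>_. lborel)"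
        by (rule measurable_fun_upd[where J = I]) (use n in auto)
      have g: "g \<in> borel_measurable (PiM I (\<lambda>_. lborel))"
        unfolding g_def by measurable
      \<comment> \<open>The induction inserts indices by increasing \<open>- r\<close>, so
        \<open>S\<close> only contains ranks at least \<open>r n\<close>. The coordinates that
        \<open>a n\<close> and \<open>b n\<close> read are thus untouched by
        \<open>P S\<close>.\<close>
      have "a n (P S x) = a n x \<and> b n (P S x) = b n x" for x
        by (rule dep[OF n]) (use insert.hyps in \<open>force simp: P_def\<close>)
      then have "f (P (insert n S) x) * (\<Prod>m\<in>insert n S. ennreal \<bar>a m x\<bar>)
          = g (P S x) * (\<Prod>m\<in>S. ennreal \<bar>a m x\<bar>)" for x
      proof -
        have "P (insert n S) x = (P S x)(n := b n x + a n x * x n)"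
          by (auto simp: P_def)
        moreover have "P S x n = x n"
          using False by (simp add: P_def)
        ultimately show ?thesis
          using False insert.hyps(1) \<open>\<And>x. a n (P S x) = a n x \<and> b n (P S x) = b n x\<close>
          by (simp add: g_def mult_ac)
      qed
      then have "(\<integral>\<^sup>+x. f (P (insert n S) x) * (\<Prod>m\<in>insert n S. ennreal \<bar>a m x\<bar>) \<partial>PiM I (\<lambda>_. lborel))
          = (\<integral>\<^sup>+x. g x \<partial>PiM I (\<lambda>_. lborel))"
        using insert.IH[OF S g] by simp
      also have "\<dots> = (\<integral>\<^sup>+x. f x \<partial>PiM I (\<lambda>_. lborel))"
        unfolding g_def
      proof (rule nn_integral_PiM_affine_coordinate[OF I n])
        have "a n (x(n := y)) = a n x \<and> b n (x(n := y)) = b n x" for x y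
          by (rule dep[OF n]) auto
        then show "a n (x(n := y)) = a n x" "b n (x(n := y)) = b n x" for x y
          by auto
      qed (use nz[OF n] in auto)
      finally show ?thesis .
    qed
  qed
  note this[OF I order_refl f]
  \<comment> \<open>Outside \<open>I\<close>, points of the product space and the restricted
    function are both \<open>undefined\<close>.\<close>
  moreover have "P I x = (\<lambda>n\<in>I. b n x + a n x * x n)" if "x \<in> space (PiM I (\<lambda>_. lborel))" for x
    using that by (auto simp: P_def fun_eq_iff space_PiM PiE_def extensional_def)
  ultimately show ?thesis
    by (simp cong: nn_integral_cong)
qed

lemma AE_PiM_lborel_neq:
  fixes c :: real
  assumes "finite I" "n \<in> I"
  shows "AE x in PiM I (\<lambda>_. lborel). x n \<noteq> c"
proof (rule AE_I')
  interpret product_sigma_finite "\<lambda>_. lborel :: real measure" by standard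
  \<comment> \<open>One side of the box is a single point; in \<open>ennreal\<close> that factor 0
    absorbs the infinite lengths of the others.\<close>
  have "emeasure (PiM I (\<lambda>_. lborel)) (PiE I (\<lambda>i. if i = n then {c} else UNIV)) = 0"
    using assms by (subst emeasure_PiM) (auto intro: prod_zero)
  then show "PiE I (\<lambda>i. if i = n then {c} else UNIV) \<in> null_sets (PiM I (\<lambda>_. lborel))"
    using assms(1) by (auto intro!: null_setsI sets_PiM_I_finite)
  show "{x \<in> space (PiM I (\<lambda>_. lborel)). \<not> x n \<noteq> c} \<subseteq> PiE I (\<lambda>i. if i = n then {c} else UNIV)"
    by (auto simp: space_PiM PiE_iff extensional_def)
qed

subsection \<open>Measurability of matrix operations\<close>

lemma borel_measurable_matrix_nth:
  fixes f :: "'a \<Rightarrow> real^'n^'m"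
  assumes "f \<in> borel_measurable M"
  shows "(\<lambda>x. f x $ i $ j) \<in> borel_measurable M"
proof -
  have "(\<lambda>A :: real^'n^'m. A $ i $ j) \<in> borel_measurable borel"
    by (intro borel_measurable_continuous_onI continuous_intros)
  from measurable_compose[OF assms this] show ?thesis .
qed

lemma borel_measurable_matrixI:
  fixes f :: "'a \<Rightarrow> real^'n^'m"
  assumes "\<And>i j. (\<lambda>x. f x $ i $ j) \<in> borel_measurable M"
  shows "f \<in> borel_measurable M"
  using assms by (subst borel_measurable_euclidean_space) (auto simp: Basis_vec_def inner_axis)

lemma borel_measurable_det:
  fixes f :: "'a \<Rightarrow> real^'n^'n"
  assumes "\<And>i j. (\<lambda>x. f x $ i $ j) \<in> borel_measurable M"
  shows "(\<lambda>x. det (f x)) \<in> borel_measurable M"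
  unfolding det_def using assms by measurable

lemma borel_measurable_principal_minor:
  assumes "\<And>i j. (\<lambda>x. f x $ i $ j) \<in> borel_measurable M"
  shows "(\<lambda>x. principal_minor (f x) C) \<in> borel_measurable M"
  unfolding principal_minor_def using assms by measurable

lemma matrix_inv_nth_cramer:
  fixes A :: "real^'n^'n"
  assumes "det A \<noteq> 0"
  shows "matrix_inv A $ i $ j
    = det (\<chi> r c. if c = i then (if r = j then 1 else 0) else A $ r $ c) / det A"
proof -
  have "A *v (matrix_inv A *v axis j 1) = axis j 1"
    using assms by (simp add: matrix_vector_mul_assoc matrix_inv_mult invertible_det_nz)
  then have "matrix_inv A *v axis j 1
      = (\<chi> k. det (\<chi> r c. if c = k then axis j 1 $ r else A $ r $ c) / det A)"
    using cramer[OF assms] by blast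
  moreover have "(matrix_inv A *v axis j 1) $ i = matrix_inv A $ i $ j"
    by (simp add: matrix_vector_mult_basis column_def)
  ultimately have "matrix_inv A $ i $ j
      = det (\<chi> r c. if c = i then axis j 1 $ r else A $ r $ c) / det A"
    by simp
  moreover have "(\<lambda>r. axis j (1 :: real) $ r) = (\<lambda>r. if r = j then 1 else 0)"
    by (auto simp: axis_def)
  ultimately show ?thesis by (simp only: fun_eq_iff)
qed

text \<open>Where the determinant is nonzero, Cramer's rule gives a quotient of polynomials in the
  entries. On singular matrices \<open>matrix_inv\<close> is an unspecified choice, so the value 0
  is substituted there.\<close>

lemma borel_measurable_matrix_inv_nth:
  fixes f :: "'a \<Rightarrow> real^'n^'n"
  assumes "f \<in> borel_measurable M"
  shows "(\<lambda>x. if det (f x) = 0 then 0 else matrix_inv (f x) $ i $ j) \<in> borel_measurable M"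
proof -
  note [measurable] = borel_measurable_matrix_nth[OF assms]
  have [measurable]: "(\<lambda>x. det (f x)) \<in> borel_measurable M"
    by (rule borel_measurable_det) measurable
  have [measurable]: "(\<lambda>x. det (\<chi> r c. if c = i then (if r = j then 1 else 0) else f x $ r $ c))
      \<in> borel_measurable M"
    by (rule borel_measurable_det) simp
  have "(\<lambda>x. if det (f x) = 0 then 0
      else det (\<chi> r c. if c = i then (if r = j then 1 else 0) else f x $ r $ c) / det (f x))
      \<in> borel_measurable M"
    by measurable
  then show ?thesis
    by (simp add: matrix_inv_nth_cramer cong: if_cong)
qed

section \<open>Measurability of the domains and of the densities\<close>

lemma pos_def_det_nonzero: "det A \<noteq> 0" if "pos_def A"
proof -
  have "x = 0" if "A *v x = 0" for x
    using that \<open>pos_def A\<close> unfolding pos_def_def by (metis inner_zero_right less_irrefl)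
  then show ?thesis
    unfolding invertible_det_nz[symmetric] invertible_left_inverse matrix_left_invertible_ker
    by blast
qed

text \<open>Positive definiteness quantifies over uncountably many vectors, so its measurability is
  obtained from openness. By scaling, unit vectors suffice; the complement is then the projection of
  a closed set along the compact sphere, hence closed.\<close>

lemma open_pos_quadratic:
  "open {A :: 'n::finite sqmat. \<forall>x. x \<noteq> 0 \<longrightarrow> x \<bullet> (A *v x) > 0}"
proof -
  have "closed {A :: 'n sqmat. \<exists>x. x \<in> sphere 0 1 \<and> (x, A) \<in> {(x, A). x \<bullet> (A *v x) \<le> 0}}"
  proof (rule closed_compact_projection)
    have "closed {p :: 'n rvec \<times> 'n sqmat. fst p \<bullet> (snd p *v fst p) \<le> 0}"
      unfolding matrix_vector_mult_def
      by (intro closed_Collect_le continuous_intros)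
    then show "closed {(x :: 'n rvec, A :: 'n sqmat). x \<bullet> (A *v x) \<le> 0}"
      by (simp add: case_prod_unfold)
  qed simp
  moreover have "{A :: 'n sqmat. \<forall>x. x \<noteq> 0 \<longrightarrow> x \<bullet> (A *v x) > 0}
      = - {A. \<exists>x. x \<in> sphere 0 1 \<and> (x, A) \<in> {(x, A). x \<bullet> (A *v x) \<le> 0}}"
  proof (intro set_eqI iffI)
    fix A :: "'n sqmat"
    assume A: "A \<in> - {A. \<exists>x. x \<in> sphere 0 1 \<and> (x, A) \<in> {(x, A). x \<bullet> (A *v x) \<le> 0}}"
    have "x \<bullet> (A *v x) > 0" if "x \<noteq> 0" for x
    proof -
      define y where "y = (1 / norm x) *\<^sub>R x"
      have "norm y = 1" and x: "x = norm x *\<^sub>R y"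
        using that by (simp_all add: y_def)
      then have "0 < y \<bullet> (A *v y)"
        using A by (auto simp: not_le)
      then have "0 < norm x * (norm x * (y \<bullet> (A *v y)))"
        using that by simp
      also have "\<dots> = x \<bullet> (A *v x)"
        by (subst (3 4) x) (simp only: matrix_vector_mult_scaleR inner_scaleR_left inner_scaleR_right)
      finally show ?thesis .
    qed
    then show "A \<in> {A. \<forall>x. x \<noteq> 0 \<longrightarrow> x \<bullet> (A *v x) > 0}" by simp
  next
    fix A :: "'n sqmat"
    assume A: "A \<in> {A. \<forall>x. x \<noteq> 0 \<longrightarrow> x \<bullet> (A *v x) > 0}"
    have "0 < x \<bullet> (A *v x)" if "norm x = 1" for x
    proof -
      have "x \<noteq> 0"
        using that by auto
      with A show ?thesis by simp
    qed
    then show "A \<in> - {A. \<exists>x. x \<in> sphere 0 1 \<and> (x, A) \<in> {(x, A). x \<bullet> (A *v x) \<le> 0}}"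
      by (auto simp: not_le[symmetric])
  qed
  ultimately show ?thesis
    by (simp add: open_Compl)
qed

lemma sets_P_G:
  fixes E :: "('n::finite \<times> 'n) set"
  shows "P_G E \<in> sets borel"
proof -
  have [measurable]: "(\<lambda>A :: 'n sqmat. A $ i $ j) \<in> borel_measurable borel" for i j
    by (rule borel_measurable_matrix_nth) simp
  have "{A \<in> space borel. \<forall>i j. A $ j $ i = A $ i $ j \<and> (i \<noteq> j \<and> (i, j) \<notin> E \<longrightarrow> A $ i $ j = 0)}
      \<in> sets (borel :: 'n sqmat measure)"
    by measurable
  then have "{A :: 'n sqmat. \<forall>i j. A $ j $ i = A $ i $ j \<and> (i \<noteq> j \<and> (i, j) \<notin> E \<longrightarrow> A $ i $ j = 0)}
      \<inter> {A. \<forall>x. x \<noteq> 0 \<longrightarrow> x \<bullet> (A *v x) > 0} \<in> sets borel"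
    using borel_open[OF open_pos_quadratic] by (intro sets.Int) simp_all
  also have "{A :: 'n sqmat. \<forall>i j. A $ j $ i = A $ i $ j \<and> (i \<noteq> j \<and> (i, j) \<notin> E \<longrightarrow> A $ i $ j = 0)}
      \<inter> {A. \<forall>x. x \<noteq> 0 \<longrightarrow> x \<bullet> (A *v x) > 0} = P_G E"
    by (auto simp: P_G_def pos_def_def transpose_def vec_eq_iff)
  finally show ?thesis .
qed

lemma sets_Theta_G:
  fixes E :: "('n::{finite,linorder} \<times> 'n) set"
  shows "Theta_G E \<in> sets borel"
proof -
  have [measurable]: "(\<lambda>p :: 'n sqmat \<times> 'n sqmat. fst p $ i $ j) \<in> borel_measurable borel"
      "(\<lambda>p :: 'n sqmat \<times> 'n sqmat. snd p $ i $ j) \<in> borel_measurable borel" for i j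
    by (intro borel_measurable_continuous_onI continuous_intros)+
  have "{p \<in> space borel. \<forall>i j. fst p $ i $ i = 1 \<and> (i < j \<longrightarrow> fst p $ i $ j = 0)
      \<and> (j < i \<and> (i, j) \<notin> E \<longrightarrow> fst p $ i $ j = 0)
      \<and> (i \<noteq> j \<longrightarrow> snd p $ i $ j = 0) \<and> 0 < snd p $ i $ i}
      \<in> sets (borel :: ('n sqmat \<times> 'n sqmat) measure)"
    by measurable
  also have "{p \<in> space borel. \<forall>i j. fst p $ i $ i = 1 \<and> (i < j \<longrightarrow> fst p $ i $ j = 0)
      \<and> (j < i \<and> (i, j) \<notin> E \<longrightarrow> fst p $ i $ j = 0)
      \<and> (i \<noteq> j \<longrightarrow> snd p $ i $ j = 0) \<and> 0 < snd p $ i $ i} = Theta_G E"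
    by (auto simp: Theta_G_def L_G_def unit_lower_def pos_diag_def)
  finally show ?thesis .
qed

lemma borel_measurable_LDLt: "LDLt \<in> borel_measurable borel"
  unfolding LDLt_def case_prod_beta matrix_matrix_mult_def transpose_def
  by (intro borel_measurable_continuous_onI continuous_intros)

text \<open>The guarded inverse \<open>inv0\<close> equals \<open>matrix_inv\<close> on
  \<open>P_G E\<close>, and the indicator hides the difference elsewhere.\<close>

lemma borel_measurable_IW_kernel_P_G:
  fixes E :: "('n::finite \<times> 'n) set"
  shows
  "(\<lambda>A. ennreal (IW_kernel E Cs U \<alpha> \<beta> A) * indicator (P_G E) A) \<in> borel_measurable borel"
proof -
  define inv0 :: "'n sqmat \<Rightarrow> 'n sqmat"
    where "inv0 A = (\<chi> i j. if det A = 0 then 0 else matrix_inv A $ i $ j)" for A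
  have [measurable]: "(\<lambda>A. inv0 A $ i $ j) \<in> borel_measurable borel" for i j
    unfolding inv0_def vec_lambda_beta by (rule borel_measurable_matrix_inv_nth) simp
  have [measurable]: "(\<lambda>A. principal_minor (inv0 A) C) \<in> borel_measurable borel" for C
    by (rule borel_measurable_principal_minor) measurable
  have [measurable]: "(\<lambda>A. trace (inv0 A ** U)) \<in> borel_measurable borel"
    unfolding trace_def matrix_matrix_mult_def vec_lambda_beta by measurable
  note [measurable] = sets_P_G[of E]
  define K where "K A = exp (- trace (inv0 A ** U) / 2)
     * (\<Prod>C\<in>cliques E. principal_minor (inv0 A) C powr (\<alpha> C + (real (card C) + 1) / 2))
     / (\<Prod>S\<in>separators Cs. principal_minor (inv0 A) S powr
          (real (sep_mult Cs S) * (\<beta> S + (real (card S) + 1) / 2)))" for A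
  have "(\<lambda>A. ennreal (K A) * indicator (P_G E) A) \<in> borel_measurable borel"
    unfolding K_def by measurable
  moreover have "ennreal (K A) * indicator (P_G E) A
      = ennreal (IW_kernel E Cs U \<alpha> \<beta> A) * indicator (P_G E) A" for A
  proof (cases "A \<in> P_G E")
    case True
    then have "inv0 A = matrix_inv A"
      using pos_def_det_nonzero[of A] by (simp add: inv0_def P_G_def vec_eq_iff)
    then show ?thesis
      by (simp only: K_def IW_kernel_def)
  qed simp
  ultimately show ?thesis by (simp only:)
qed

lemma borel_measurable_pi_kernel_Theta_G:
  fixes E :: "('n::{finite,linorder} \<times> 'n) set"
  shows
  "(\<lambda>\<theta>. ennreal (pi_kernel U \<alpha>' \<theta>) * indicator (Theta_G E) \<theta>) \<in> borel_measurable borel"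
proof -
  define inv0 :: "'n sqmat \<times> 'n sqmat \<Rightarrow> 'n sqmat"
    where "inv0 \<theta> = (\<chi> i j. if det (LDLt \<theta>) = 0 then 0 else matrix_inv (LDLt \<theta>) $ i $ j)" for \<theta>
  have [measurable]: "(\<lambda>\<theta>. inv0 \<theta> $ i $ j) \<in> borel_measurable borel" for i j
    unfolding inv0_def vec_lambda_beta
    by (rule borel_measurable_matrix_inv_nth) (rule borel_measurable_LDLt)
  have [measurable]: "(\<lambda>\<theta>. trace (inv0 \<theta> ** U)) \<in> borel_measurable borel"
    unfolding trace_def matrix_matrix_mult_def vec_lambda_beta by measurable
  have [measurable]: "(\<lambda>\<theta> :: 'n sqmat \<times> 'n sqmat. snd \<theta> $ i $ j) \<in> borel_measurable borel" for i j
    by (intro borel_measurable_continuous_onI continuous_intros)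
  note [measurable] = sets_Theta_G[of E]
  define K where "K \<theta>
      = exp (- (trace (inv0 \<theta> ** U) + (\<Sum>i\<in>UNIV. \<alpha>' $ i * ln (snd \<theta> $ i $ i))) / 2)" for \<theta>
  have "(\<lambda>\<theta>. ennreal (K \<theta>) * indicator (Theta_G E) \<theta>) \<in> borel_measurable borel"
    unfolding K_def by measurable
  moreover have "ennreal (K \<theta>) * indicator (Theta_G E) \<theta>
      = ennreal (pi_kernel U \<alpha>' \<theta>) * indicator (Theta_G E) \<theta>" for \<theta>
  proof (cases "\<theta> \<in> Theta_G E")
    case True
    obtain L D where \<theta>: "\<theta> = (L, D)" by fastforce
    with True have "pos_def (LDLt \<theta>)"
      using pos_def_LDLt_iff[of L D] by (simp add: Theta_G_def L_G_def pos_diag_def)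
    from pos_def_det_nonzero[OF this] have "inv0 \<theta> = matrix_inv (LDLt \<theta>)"
      by (simp add: inv0_def vec_eq_iff)
    then show ?thesis
      by (simp only: K_def pi_kernel_def \<theta> case_prod_conv snd_conv)
  qed simp
  ultimately show ?thesis by (simp only:)
qed

subsection \<open>The Cholesky change of variables\<close>

text \<open>Storing \<open>D\<close> in the diagonal coordinates gives \<open>(L, D)\<close> the
  same coordinate space as \<open>sym_of_coords\<close>, so both reference measures become images of
  one product measure.\<close>

definition theta_of_coords ::
    "('n \<times> 'n) set \<Rightarrow> ('n \<times> 'n \<Rightarrow> real) \<Rightarrow> 'n::{finite,linorder} sqmat \<times> 'n sqmat" where
  "theta_of_coords E x = (lower_of_coords E x, diag_of_coords (\<lambda>i. x (i, i)))"

lemma lower_of_coords_L_G: "lower_of_coords E x \<in> L_G E"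
  by (auto simp: L_G_def unit_lower_def lower_of_coords_def lower_edges_def)

lemma theta_of_coords_Theta_G_iff:
  "theta_of_coords E x \<in> Theta_G E \<longleftrightarrow> (\<forall>i. 0 < x (i, i))"
  by (simp add: theta_of_coords_def Theta_G_def lower_of_coords_L_G pos_diag_def diag_of_coords_def)

lemma borel_measurable_lower_of_coords_nth:
  fixes E :: "('n::{finite,linorder} \<times> 'n) set"
  shows "(\<lambda>x. lower_of_coords E x $ i $ j)
    \<in> borel_measurable (PiM (Id \<union> lower_edges E) (\<lambda>_. lborel))"
proof (cases "i \<noteq> j \<and> (i, j) \<in> lower_edges E")
  case True
  then have "(\<lambda>x. x (i, j)) \<in> borel_measurable (PiM (Id \<union> lower_edges E) (\<lambda>_. lborel))"
    using measurable_component_singleton[of "(i, j)" "Id \<union> lower_edges E" "\<lambda>_. lborel"] by simp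
  with True show ?thesis by (simp add: lower_of_coords_def)
next
  case False
  then have "lower_of_coords E x $ i $ j = (if i = j then 1 else 0)" for x
    by (auto simp: lower_of_coords_def)
  then show ?thesis by simp
qed

lemma borel_measurable_theta_of_coords:
  fixes E :: "('n::{finite,linorder} \<times> 'n) set"
  shows "theta_of_coords E \<in> borel_measurable (PiM (Id \<union> lower_edges E) (\<lambda>_. lborel))"
proof -
  let ?I = "Id \<union> lower_edges E"
  have "lower_of_coords E \<in> borel_measurable (PiM ?I (\<lambda>_. lborel))"
    by (rule borel_measurable_matrixI) (rule borel_measurable_lower_of_coords_nth)
  moreover have "(\<lambda>x. diag_of_coords (\<lambda>i. x (i, i)) :: 'n sqmat) \<in> borel_measurable (PiM ?I (\<lambda>_. lborel))"
    by (rule borel_measurable_matrixI) (simp add: diag_of_coords_def)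
  ultimately show ?thesis
    unfolding theta_of_coords_def by (rule borel_measurable_Pair)
qed

lemma borel_measurable_sym_of_coords:
  fixes E :: "('n::{finite,linorder} \<times> 'n) set"
  assumes "undirected_graph E"
  shows "sym_of_coords E \<in> borel_measurable (PiM (Id \<union> lower_edges E) (\<lambda>_. lborel))"
proof (rule borel_measurable_matrixI)
  fix i j :: 'n
  show "(\<lambda>x. sym_of_coords E x $ i $ j) \<in> borel_measurable (PiM (Id \<union> lower_edges E) (\<lambda>_. lborel))"
  proof (cases "i = j \<or> (i, j) \<in> E")
    case True
    then have "(max i j, min i j) \<in> Id \<union> lower_edges E"
      using assms
      by (cases i j rule: linorder_cases)
        (auto simp: max_def min_def lower_edges_def undirected_graph_def sym_def)
    then have "(\<lambda>x. x (max i j, min i j)) \<in> borel_measurable (PiM (Id \<union> lower_edges E) (\<lambda>_. lborel))"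
      using measurable_component_singleton[of "(max i j, min i j)" "Id \<union> lower_edges E" "\<lambda>_. lborel"]
      by simp
    with True show ?thesis by (simp add: sym_of_coords_def)
  qed (simp add: sym_of_coords_def)
qed

text \<open>The regrouping \<open>h\<close> of the two coordinate families preserves the product
  measure: the preimage of a box is a product of two boxes, and the diagonal and
  \<open>lower_edges E\<close> are disjoint.\<close>

lemma lebesgue_Theta_G_eq:
  fixes E :: "('n::{finite,linorder} \<times> 'n) set"
  shows "lebesgue_Theta_G E
    = distr (PiM (Id \<union> lower_edges E) (\<lambda>_. lborel)) borel (theta_of_coords E)"
proof -
  let ?I = "Id \<union> lower_edges E"
  let ?P = "PiM (lower_edges E) (\<lambda>_. lborel) \<Otimes>\<^sub>M PiM UNIV (\<lambda>_. lborel)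
    :: (('n \<times> 'n \<Rightarrow> real) \<times> ('n \<Rightarrow> real)) measure"
  define h :: "('n \<times> 'n \<Rightarrow> real) \<times> ('n \<Rightarrow> real) \<Rightarrow> 'n \<times> 'n \<Rightarrow> real"
    where "h p = (\<lambda>n\<in>?I. if fst n = snd n then snd p (fst n) else fst p n)" for p
  interpret pn: product_sigma_finite "\<lambda>_::'n. lborel :: real measure" by standard
  interpret pnn: product_sigma_finite "\<lambda>_::'n \<times> 'n. lborel :: real measure" by standard
  interpret fn: finite_product_sigma_finite "\<lambda>_::'n. lborel :: real measure" UNIV
    by standard simp
  interpret fnn: finite_product_sigma_finite "\<lambda>_::'n \<times> 'n. lborel :: real measure" "lower_edges E"
    by standard simp
  have h_meas [measurable]: "h \<in> ?P \<rightarrow>\<^sub>M PiM ?I (\<lambda>_. lborel)"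
    unfolding h_def
  proof (rule measurable_restrict)
    fix n assume n: "n \<in> ?I"
    show "(\<lambda>p. if fst n = snd n then snd p (fst n) else fst p n) \<in> ?P \<rightarrow>\<^sub>M lborel"
    proof (cases "fst n = snd n")
      case True
      then show ?thesis by simp
    next
      case False
      with n have "n \<in> lower_edges E" by (cases n) auto
      with False show ?thesis by simp
    qed
  qed
  have "distr ?P (PiM ?I (\<lambda>_. lborel)) h = PiM ?I (\<lambda>_. lborel)"
  proof (rule pnn.PiM_eqI)
    fix A :: "'n \<times> 'n \<Rightarrow> real set" assume A: "\<And>i. i \<in> ?I \<Longrightarrow> A i \<in> sets lborel"
    have "h (x, d) \<in> PiE ?I A \<longleftrightarrow> (\<forall>i. d i \<in> A (i, i)) \<and> (\<forall>n\<in>lower_edges E. x n \<in> A n)" for x d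
    proof -
      have "h (x, d) (i, i) = d i" for i
        by (simp add: h_def)
      moreover have "h (x, d) n = x n" if "n \<in> lower_edges E" for n
        using that by (auto simp: h_def lower_edges_def)
      moreover have "h (x, d) \<in> extensional ?I"
        by (simp add: h_def)
      ultimately show ?thesis
        unfolding PiE_iff ball_Un by (metis IdE IdI)
    qed
    then have "(x, d) \<in> h -` PiE ?I A \<inter> space ?P
        \<longleftrightarrow> (x, d) \<in> PiE (lower_edges E) A \<times> PiE UNIV (\<lambda>i. A (i, i))" for x d
      unfolding vimage_eq Int_iff space_pair_measure space_PiM mem_Times_iff fst_conv snd_conv
        PiE_iff[of x "lower_edges E"] PiE_iff[of d] by auto
    then have "h -` PiE ?I A \<inter> space ?P = PiE (lower_edges E) A \<times> PiE UNIV (\<lambda>i. A (i, i))"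
      by (intro set_eqI) (simp only: split_paired_all)
    then have "emeasure (distr ?P (PiM ?I (\<lambda>_. lborel)) h) (PiE ?I A)
        = emeasure ?P (PiE (lower_edges E) A \<times> PiE UNIV (\<lambda>i. A (i, i)))"
      using A by (subst emeasure_distr) (auto intro!: sets_PiM_I_finite)
    also have "\<dots> = (\<Prod>n\<in>lower_edges E. emeasure lborel (A n)) * (\<Prod>i\<in>UNIV. emeasure lborel (A (i, i)))"
      using A by (subst fn.emeasure_pair_measure_Times)
        (auto intro!: sets_PiM_I_finite simp: pn.emeasure_PiM pnn.emeasure_PiM)
    also have "(\<Prod>i\<in>UNIV. emeasure lborel (A (i, i))) = (\<Prod>n\<in>Id. emeasure lborel (A n))"
      by (rule prod.reindex_bij_witness[of _ fst "\<lambda>i. (i, i)"]) auto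
    also have "(\<Prod>n\<in>lower_edges E. emeasure lborel (A n)) * (\<Prod>n\<in>Id. emeasure lborel (A n))
        = (\<Prod>n\<in>?I. emeasure lborel (A n))"
      by (subst prod.union_disjoint) (auto simp: lower_edges_def mult.commute)
    finally show "emeasure (distr ?P (PiM ?I (\<lambda>_. lborel)) h) (PiE ?I A)
        = (\<Prod>n\<in>?I. emeasure lborel (A n))" .
  qed simp_all
  then have "distr (PiM ?I (\<lambda>_. lborel)) borel (theta_of_coords E)
      = distr (distr ?P (PiM ?I (\<lambda>_. lborel)) h) borel (theta_of_coords E)"
    by simp
  also have "\<dots> = distr ?P borel (theta_of_coords E \<circ> h)"
    by (rule distr_distr[OF borel_measurable_theta_of_coords h_meas])
  also have "theta_of_coords E \<circ> h = (\<lambda>(x, d). (lower_of_coords E x, diag_of_coords d))"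
    by (auto simp: fun_eq_iff theta_of_coords_def h_def lower_of_coords_def diag_of_coords_def
        vec_eq_iff lower_edges_def)
  finally show ?thesis
    by (simp add: lebesgue_Theta_G_def)
qed

lemma nn_integral_lebesgue_Theta_G:
  fixes E :: "('n::{finite,linorder} \<times> 'n) set"
  assumes "f \<in> borel_measurable borel"
  shows "(\<integral>\<^sup>+\<theta>. f \<theta> \<partial>lebesgue_Theta_G E)
    = (\<integral>\<^sup>+x. f (theta_of_coords E x) \<partial>PiM (Id \<union> lower_edges E) (\<lambda>_. lborel))"
  unfolding lebesgue_Theta_G_eq
  by (rule nn_integral_distr[OF borel_measurable_theta_of_coords]) (use assms in simp)

text \<open>This is the triangular structure: column \<open>j\<close> enters only through the last
  summand, which is \<open>x (j, j)\<close> on the diagonal and \<open>x (i, j) * x (j, j)\<close>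
  at an edge. The sum reads earlier columns.\<close>

lemma LDLt_lower_entry:
  fixes E :: "('n::{finite,linorder} \<times> 'n) set"
  assumes "j \<le> i"
  shows "LDLt (theta_of_coords E x) $ i $ j
    = (\<Sum>k\<in>{..<j}. lower_of_coords E x $ i $ k * x (k, k) * lower_of_coords E x $ j $ k)
      + lower_of_coords E x $ i $ j * x (j, j)"
proof -
  let ?L = "lower_of_coords E x"
  have "LDLt (theta_of_coords E x) $ i $ j = (\<Sum>k\<in>UNIV. ?L $ i $ k * x (k, k) * ?L $ j $ k)"
    unfolding theta_of_coords_def by (subst LDLt_nth) (auto simp: diag_of_coords_def)
  also have "\<dots> = (\<Sum>k\<in>{..j}. ?L $ i $ k * x (k, k) * ?L $ j $ k)"
    by (rule sum.mono_neutral_right) (auto simp: lower_of_coords_def lower_edges_def)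
  also have "{..j} = insert j {..<j}"
    by auto
  finally show ?thesis
    by (simp add: lower_of_coords_def)
qed

lemma nn_integral_lebesgue_P_G:
  fixes E :: "('n::{finite,linorder} \<times> 'n) set"
  assumes G: "undirected_graph E" "S_H E" and f: "f \<in> borel_measurable borel"
  shows "(\<integral>\<^sup>+A. f A \<partial>lebesgue_P_G E)
    = (\<integral>\<^sup>+x. f (LDLt (theta_of_coords E x)) * ennreal (\<Prod>(i, j)\<in>lower_edges E. \<bar>x (j, j)\<bar>)
        \<partial>PiM (Id \<union> lower_edges E) (\<lambda>_. lborel))"
proof -
  let ?I = "Id \<union> lower_edges E"
  let ?M = "PiM ?I (\<lambda>_. lborel) :: ('n \<times> 'n \<Rightarrow> real) measure"
  have sym: "(y, x) \<in> E" if "(x, y) \<in> E" for x y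
    using G(1) that by (auto simp: undirected_graph_def sym_def)
  \<comment> \<open>The value \<open>1\<close> at \<open>x (j, j) = 0\<close> makes every coordinate map invertible and changes only a null set.\<close>
  define a :: "'n \<times> 'n \<Rightarrow> ('n \<times> 'n \<Rightarrow> real) \<Rightarrow> real" where
    "a n x = (if fst n = snd n \<or> x (snd n, snd n) = 0 then 1 else x (snd n, snd n))" for n x
  define b :: "'n \<times> 'n \<Rightarrow> ('n \<times> 'n \<Rightarrow> real) \<Rightarrow> real" where
    "b n x = (\<Sum>k\<in>{..<snd n}. lower_of_coords E x $ fst n $ k * x (k, k)
      * lower_of_coords E x $ snd n $ k)" for n x
  \<comment> \<open>Columns come in increasing order, and within a column the diagonal coordinate
    precedes the others, whose coefficient it is. The factor 2 makes room for this
    tie-break.\<close>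
  define r :: "'n \<times> 'n \<Rightarrow> int" where
    "r n = 2 * int (card {..<snd n}) + (if fst n = snd n then 0 else 1)" for n
  have r_less: "r (i, k) < r n" if "k < snd n" for i k n
  proof -
    have "card {..<k} < card {..<snd n}"
      by (rule psubset_card_mono) (use that in auto)
    then show ?thesis by (simp add: r_def)
  qed
  have f_sym: "(\<lambda>x. f (sym_of_coords E x)) \<in> borel_measurable ?M"
    using measurable_compose[OF borel_measurable_sym_of_coords[OF G(1)] f] .
  have [measurable]: "(\<lambda>x. lower_of_coords E x $ i $ k) \<in> borel_measurable ?M" for i k
    by (rule borel_measurable_lower_of_coords_nth)
  have "(\<integral>\<^sup>+A. f A \<partial>lebesgue_P_G E) = (\<integral>\<^sup>+x. f (sym_of_coords E x) \<partial>?M)"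
    unfolding lebesgue_P_G_def
    by (rule nn_integral_distr[OF borel_measurable_sym_of_coords[OF G(1)]]) (use f in simp)
  also have "\<dots> = (\<integral>\<^sup>+x. f (sym_of_coords E (\<lambda>n\<in>?I. b n x + a n x * x n))
      * (\<Prod>n\<in>?I. ennreal \<bar>a n x\<bar>) \<partial>?M)"
  proof (rule nn_integral_PiM_triangular[symmetric, where r = r])
    show "a n \<in> borel_measurable ?M" "b n \<in> borel_measurable ?M" for n
      unfolding a_def b_def by measurable
    show "a n x \<noteq> 0" for n x
      by (simp add: a_def)
    fix n :: "'n \<times> 'n" and x y :: "'n \<times> 'n \<Rightarrow> real"
    assume n: "n \<in> ?I" and xy: "\<And>m. m \<in> ?I \<Longrightarrow> r m < r n \<Longrightarrow> x m = y m"
    have "lower_of_coords E x $ i $ k = lower_of_coords E y $ i $ k" if "k < snd n" for i k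
      using xy[of "(i, k)"] r_less[OF that] by (simp add: lower_of_coords_def)
    moreover have "x (k, k) = y (k, k)" if "k < snd n" for k
      using xy[of "(k, k)"] r_less[OF that] by simp
    ultimately have "b n x = b n y"
      unfolding b_def by (intro sum.cong) auto
    moreover have "fst n = snd n \<or> x (snd n, snd n) = y (snd n, snd n)"
      using xy[of "(snd n, snd n)"] by (cases "fst n = snd n") (simp_all add: r_def)
    then have "a n x = a n y"
      unfolding a_def by auto
    ultimately show "a n x = a n y \<and> b n x = b n y"
      by simp
  qed (use f_sym in auto)
  also have "\<dots> = (\<integral>\<^sup>+x. f (LDLt (theta_of_coords E x))
      * ennreal (\<Prod>(i, j)\<in>lower_edges E. \<bar>x (j, j)\<bar>) \<partial>?M)"
  proof (rule nn_integral_cong_AE)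
    have "AE x in ?M. \<forall>j\<in>UNIV. x (j, j) \<noteq> 0"
      by (intro AE_finite_allI AE_PiM_lborel_neq) auto
    then show "AE x in ?M. f (sym_of_coords E (\<lambda>n\<in>?I. b n x + a n x * x n))
        * (\<Prod>n\<in>?I. ennreal \<bar>a n x\<bar>)
      = f (LDLt (theta_of_coords E x)) * ennreal (\<Prod>(i, j)\<in>lower_edges E. \<bar>x (j, j)\<bar>)"
    proof eventually_elim
      case (elim x)
      then have nz: "x (j, j) \<noteq> 0" for j
        by simp
      have lower: "sym_of_coords E (\<lambda>n\<in>?I. b n x + a n x * x n) $ i $ j
          = LDLt (theta_of_coords E x) $ i $ j" if ji: "j \<le> i" for i j
      proof (cases "i = j \<or> (i, j) \<in> E")
        case True
        then have "(i, j) \<in> ?I"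
          using ji by (auto simp: lower_edges_def)
        moreover have "max i j = i" "min i j = j"
          using ji by simp_all
        ultimately have "sym_of_coords E (\<lambda>n\<in>?I. b n x + a n x * x n) $ i $ j
            = b (i, j) x + a (i, j) x * x (i, j)"
          using True by (simp add: sym_of_coords_def)
        moreover have "a (i, j) x * x (i, j) = lower_of_coords E x $ i $ j * x (j, j)"
          using \<open>(i, j) \<in> ?I\<close> nz by (auto simp: a_def lower_of_coords_def)
        ultimately show ?thesis
          unfolding LDLt_lower_entry[OF ji] by (simp add: b_def)
      next
        case False
        with ji have "j < i" by auto
        \<comment> \<open>No fill-in: if both factors from \<open>L\<close> were nonzero,
          \<open>i\<close> and \<open>j\<close> would be upper neighbours of \<open>k\<close> and
          hence adjacent.\<close>
        have "lower_of_coords E x $ i $ k * x (k, k) * lower_of_coords E x $ j $ k = 0"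
          if "k < j" for k
          using S_H_upper_nbrs_adjacent[OF G(2), of k j i] False that \<open>j < i\<close>
          by (auto simp: lower_of_coords_def lower_edges_def)
        then have "(\<Sum>k<j. lower_of_coords E x $ i $ k * x (k, k) * lower_of_coords E x $ j $ k) = 0"
          by (intro sum.neutral) blast
        moreover have "lower_of_coords E x $ i $ j = 0"
          using False by (auto simp: lower_of_coords_def lower_edges_def)
        ultimately show ?thesis
          using False unfolding LDLt_lower_entry[OF ji] by (simp add: sym_of_coords_def)
      qed
      have LDLt_sym: "LDLt (theta_of_coords E x) $ i $ j = LDLt (theta_of_coords E x) $ j $ i" for i j
        unfolding theta_of_coords_def
        by (subst (1 2) LDLt_nth) (auto simp: diag_of_coords_def mult_ac)
      have "sym_of_coords E (\<lambda>n\<in>?I. b n x + a n x * x n) = LDLt (theta_of_coords E x)"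
      proof (intro vec_eq_iff[THEN iffD2] allI)
        fix i j
        have sym_of_coords_sym: "sym_of_coords E z $ i $ j = sym_of_coords E z $ j $ i" for z
          using sym by (auto simp: sym_of_coords_def max.commute min.commute)
        show "sym_of_coords E (\<lambda>n\<in>?I. b n x + a n x * x n) $ i $ j
            = LDLt (theta_of_coords E x) $ i $ j"
        proof (cases "j \<le> i")
          case True
          then show ?thesis by (rule lower)
        next
          case False
          then have "i \<le> j" by simp
          then show ?thesis
            unfolding sym_of_coords_sym LDLt_sym[of i j] by (rule lower)
        qed
      qed
      moreover have "(\<Prod>n\<in>?I. ennreal \<bar>a n x\<bar>)
          = ennreal (\<Prod>(i, j)\<in>lower_edges E. \<bar>x (j, j)\<bar>)"
      proof -
        have "(\<Prod>n\<in>?I. ennreal \<bar>a n x\<bar>) = (\<Prod>n\<in>lower_edges E. ennreal \<bar>a n x\<bar>)"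
          by (rule prod.mono_neutral_right) (auto simp: a_def)
        also have "\<dots> = (\<Prod>(i, j)\<in>lower_edges E. ennreal \<bar>x (j, j)\<bar>)"
          by (rule prod.cong) (use nz in \<open>auto simp: a_def lower_edges_def\<close>)
        finally show ?thesis
          by (simp add: case_prod_beta prod_ennreal)
      qed
      ultimately show ?case by simp
    qed
  qed
  finally show ?thesis .
qed

subsection \<open>Matching the densities\<close>

text \<open>The last summand is the exponent of \<open>D\<^sub>i\<^sub>i\<close> in the Jacobian; the factor \<open>2\<close> undoes the
  \<open>1 / 2\<close> in \<^const>\<open>pi_kernel\<close>.\<close>

definition IW_shape ::
    "(('n::{finite,linorder}) \<times> 'n) set \<Rightarrow> 'n set list \<Rightarrow> ('n set \<Rightarrow> real) \<Rightarrow> ('n set \<Rightarrow> real)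
      \<Rightarrow> 'n rvec" where
  "IW_shape E Cs \<alpha> \<beta> = (\<chi> i. 2 *
     ((\<Sum>C | C \<in> cliques E \<and> i \<in> C. \<alpha> C + (real (card C) + 1) / 2)
      - (\<Sum>S | S \<in> separators Cs \<and> i \<in> S. real (sep_mult Cs S) * (\<beta> S + (real (card S) + 1) / 2))
      - real (card {k. (k, i) \<in> lower_edges E})))"

text \<open>Counting the incidences of \<open>i\<close> in \<open>C\<close> the other way round
  collects the total exponent of each \<open>D $ i $ i\<close>.\<close>

lemma sum_mult_sum_members:
  fixes F :: "'n::finite set set" and p :: "'n set \<Rightarrow> real"
  shows "(\<Sum>C\<in>F. p C * (\<Sum>i\<in>C. l i)) = (\<Sum>i\<in>UNIV. (\<Sum>C | C \<in> F \<and> i \<in> C. p C) * l i)"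
proof -
  have "(\<Sum>C\<in>F. p C * (\<Sum>i\<in>C. l i)) = (\<Sum>C\<in>F. \<Sum>i\<in>UNIV. if i \<in> C then p C * l i else 0)"
    by (simp add: sum_distrib_left sum.If_cases)
  also have "\<dots> = (\<Sum>i\<in>UNIV. \<Sum>C\<in>F. if i \<in> C then p C * l i else 0)"
    by (rule sum.swap)
  also have "\<dots> = (\<Sum>i\<in>UNIV. (\<Sum>C | C \<in> F \<and> i \<in> C. p C) * l i)"
    by (auto simp: sum_distrib_right sum.inter_filter intro!: sum.cong)
  finally show ?thesis .
qed

text \<open>With \<open>D $ i $ i = exp (l i)\<close> every minor power and the Jacobian become
  exponentials of linear forms in \<open>l\<close>. Minors are products of reciprocals of
  \<open>D $ i $ i\<close>, so clique exponents enter with a minus sign and separator exponents with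
  a plus.\<close>

lemma IW_kernel_LDLt:
  fixes E :: "('n::{finite,linorder} \<times> 'n) set"
  assumes G: "undirected_graph E" "S_H E" and po: "perfect_order E Cs"
    and \<theta>: "(L, D) \<in> Theta_G E"
  shows "IW_kernel E Cs U \<alpha> \<beta> (LDLt (L, D)) * (\<Prod>(i, j)\<in>lower_edges E. D $ j $ j)
    = pi_kernel U (IW_shape E Cs \<alpha> \<beta>) (L, D)"
proof -
  define l where "l i = ln (D $ i $ i)" for i
  define p where "p C = \<alpha> C + (real (card C) + 1) / 2" for C :: "'n set"
  define s where "s S = real (sep_mult Cs S) * (\<beta> S + (real (card S) + 1) / 2)" for S
  let ?t = "trace (matrix_inv (LDLt (L, D)) ** U)"
  have D: "D $ i $ i = exp (l i)" for i
    using \<theta> by (simp add: l_def Theta_G_def pos_diag_def)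
  have minor: "principal_minor (matrix_inv (LDLt (L, D))) C powr q = exp (- (q * (\<Sum>i\<in>C. l i)))"
    if "up_closed E C" for C q
  proof -
    have "principal_minor (matrix_inv (LDLt (L, D))) C = (\<Prod>i\<in>C. 1 / D $ i $ i)"
      by (rule principal_minor_inv_LDLt) (use G \<theta> that in \<open>auto simp: Theta_G_def\<close>)
    also have "\<dots> = exp (\<Sum>i\<in>C. - l i)"
      by (simp add: exp_sum D exp_minus divide_inverse)
    finally show ?thesis
      by (simp add: powr_def sum_negf)
  qed
  have C: "(\<Prod>C\<in>cliques E. principal_minor (matrix_inv (LDLt (L, D))) C powr p C)
      = exp (- (\<Sum>C\<in>cliques E. p C * (\<Sum>i\<in>C. l i)))"
    by (simp add: minor clique_up_closed[OF G] exp_sum flip: sum_negf)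
  have S: "(\<Prod>S\<in>separators Cs. principal_minor (matrix_inv (LDLt (L, D))) S powr s S)
      = exp (- (\<Sum>S\<in>separators Cs. s S * (\<Sum>i\<in>S. l i)))"
    by (simp add: minor separator_up_closed[OF G po] exp_sum flip: sum_negf)
  have J: "(\<Prod>(i, j)\<in>lower_edges E. D $ j $ j)
      = exp (\<Sum>j\<in>UNIV. real (card {k. (k, j) \<in> lower_edges E}) * l j)"
  proof -
    have "(\<Prod>(i, j)\<in>lower_edges E. D $ j $ j) = exp (\<Sum>(i, j)\<in>lower_edges E. l j)"
      by (simp add: exp_sum D case_prod_beta)
    also have "(\<Sum>(i, j)\<in>lower_edges E. l j)
        = (\<Sum>(j, i)\<in>(SIGMA j:UNIV. {k. (k, j) \<in> lower_edges E}). l j)"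
      by (rule sum.reindex_bij_witness[of _ "\<lambda>(j, i). (i, j)" "\<lambda>(i, j). (j, i)"]) auto
    also have "\<dots> = (\<Sum>j\<in>UNIV. real (card {k. (k, j) \<in> lower_edges E}) * l j)"
      by (subst sum.Sigma[symmetric]) auto
    finally show ?thesis .
  qed
  have "- ?t / 2 - (\<Sum>C\<in>cliques E. p C * (\<Sum>i\<in>C. l i)) + (\<Sum>S\<in>separators Cs. s S * (\<Sum>i\<in>S. l i))
        + (\<Sum>j\<in>UNIV. real (card {k. (k, j) \<in> lower_edges E}) * l j)
      = - (?t + (\<Sum>i\<in>UNIV. IW_shape E Cs \<alpha> \<beta> $ i * l i)) / 2"
    unfolding sum_mult_sum_members
    by (simp add: IW_shape_def p_def s_def left_diff_distrib sum_subtractf mult.assoc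
        flip: sum_distrib_left)
  then show ?thesis
    unfolding IW_kernel_def pi_kernel_def case_prod_conv p_def[symmetric] s_def[symmetric] C S J
    by (simp add: l_def flip: exp_add exp_diff)
qed

lemma IW_kernel_nonneg: "0 \<le> IW_kernel E Cs U \<alpha> \<beta> A"
  by (auto simp: IW_kernel_def intro!: divide_nonneg_nonneg mult_nonneg_nonneg prod_nonneg)

text \<open>The test function \<open>g\<close> lets one identity serve twice: a constant compares
  the normalizing constants, a scaled indicator compares the measures of a set.\<close>

lemma nn_integral_IW_kernel:
  fixes E :: "('n::{finite,linorder} \<times> 'n) set"
  assumes G: "undirected_graph E" "S_H E" and po: "perfect_order E Cs"
    and g: "g \<in> borel_measurable borel"
  shows "(\<integral>\<^sup>+A. ennreal (IW_kernel E Cs U \<alpha> \<beta> A) * indicator (P_G E) A * g A \<partial>lebesgue_P_G E)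
    = (\<integral>\<^sup>+\<theta>. ennreal (pi_kernel U (IW_shape E Cs \<alpha> \<beta>) \<theta>) * indicator (Theta_G E) \<theta> * g (LDLt \<theta>)
        \<partial>lebesgue_Theta_G E)"
proof -
  let ?M = "PiM (Id \<union> lower_edges E) (\<lambda>_. lborel) :: ('n \<times> 'n \<Rightarrow> real) measure"
  have gL: "(\<lambda>\<theta>. g (LDLt \<theta>)) \<in> borel_measurable borel"
    using measurable_compose[OF borel_measurable_LDLt g] .
  have "(\<integral>\<^sup>+A. ennreal (IW_kernel E Cs U \<alpha> \<beta> A) * indicator (P_G E) A * g A \<partial>lebesgue_P_G E)
      = (\<integral>\<^sup>+x. ennreal (IW_kernel E Cs U \<alpha> \<beta> (LDLt (theta_of_coords E x)))
          * indicator (P_G E) (LDLt (theta_of_coords E x)) * g (LDLt (theta_of_coords E x))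
          * ennreal (\<Prod>(i, j)\<in>lower_edges E. \<bar>x (j, j)\<bar>) \<partial>?M)"
    by (rule nn_integral_lebesgue_P_G[OF G])
      (rule borel_measurable_times_ennreal[OF borel_measurable_IW_kernel_P_G g])
  also have "\<dots> = (\<integral>\<^sup>+x. ennreal (pi_kernel U (IW_shape E Cs \<alpha> \<beta>) (theta_of_coords E x))
          * indicator (Theta_G E) (theta_of_coords E x) * g (LDLt (theta_of_coords E x)) \<partial>?M)"
  proof (rule nn_integral_cong)
    fix x
    let ?\<theta> = "theta_of_coords E x"
    have iff: "LDLt ?\<theta> \<in> P_G E \<longleftrightarrow> ?\<theta> \<in> Theta_G E"
      unfolding theta_of_coords_def
      by (rule LDLt_in_P_G_iff[OF G(2) lower_of_coords_L_G]) (simp add: diag_of_coords_def)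
    show "ennreal (IW_kernel E Cs U \<alpha> \<beta> (LDLt ?\<theta>)) * indicator (P_G E) (LDLt ?\<theta>) * g (LDLt ?\<theta>)
          * ennreal (\<Prod>(i, j)\<in>lower_edges E. \<bar>x (j, j)\<bar>)
        = ennreal (pi_kernel U (IW_shape E Cs \<alpha> \<beta>) ?\<theta>) * indicator (Theta_G E) ?\<theta> * g (LDLt ?\<theta>)"
    proof (cases "?\<theta> \<in> Theta_G E")
      case True
      then have pos: "\<bar>x (j, j)\<bar> = x (j, j)" for j
        by (simp add: theta_of_coords_Theta_G_iff less_imp_le)
      have "IW_kernel E Cs U \<alpha> \<beta> (LDLt ?\<theta>) * (\<Prod>(i, j)\<in>lower_edges E. \<bar>x (j, j)\<bar>)
          = pi_kernel U (IW_shape E Cs \<alpha> \<beta>) ?\<theta>"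
        using IW_kernel_LDLt[OF G po True[unfolded theta_of_coords_def]]
        by (simp add: theta_of_coords_def diag_of_coords_def pos)
      then have "ennreal (IW_kernel E Cs U \<alpha> \<beta> (LDLt ?\<theta>)) * ennreal (\<Prod>(i, j)\<in>lower_edges E. \<bar>x (j, j)\<bar>)
          = ennreal (pi_kernel U (IW_shape E Cs \<alpha> \<beta>) ?\<theta>)"
        by (simp add: IW_kernel_nonneg prod_nonneg case_prod_beta flip: ennreal_mult)
      with True iff show ?thesis
        by (simp add: mult_ac)
    qed (use iff in simp)
  qed
  also have "\<dots> = (\<integral>\<^sup>+\<theta>. ennreal (pi_kernel U (IW_shape E Cs \<alpha> \<beta>) \<theta>) * indicator (Theta_G E) \<theta>
      * g (LDLt \<theta>) \<partial>lebesgue_Theta_G E)"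
    by (rule nn_integral_lebesgue_Theta_G[symmetric])
      (rule borel_measurable_times_ennreal[OF borel_measurable_pi_kernel_Theta_G gL])
  finally show ?thesis .
qed

subsection \<open>Nonnegativity of the shape parameters\<close>

text \<open>With the other coordinates fixed, the integrand stays bounded away from \<open>0\<close> as
  \<open>D $ i $ i\<close> grows, unless \<open>\<alpha>' $ i\<close> is positive.\<close>

lemma z_G_finite_imp_pos:
  fixes E :: "('n::{finite,linorder} \<times> 'n) set"
  assumes fin: "z_G E U \<alpha>' < \<infinity>"
  shows "0 < \<alpha>' $ i"
proof (rule ccontr)
  assume "\<not> 0 < \<alpha>' $ i"
  then have \<alpha>': "\<alpha>' $ i \<le> 0" by simp
  let ?I = "Id \<union> lower_edges E"
  define J where "J = ?I - {(i, i)}"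
  have I: "?I = insert (i, i) J" "(i, i) \<notin> J" "finite J"
    by (auto simp: J_def)
  interpret product_sigma_finite "\<lambda>_::'n \<times> 'n. lborel :: real measure" by standard
  define F where "F x = ennreal (pi_kernel U \<alpha>' (theta_of_coords E x))
    * indicator (Theta_G E) (theta_of_coords E x)" for x
  \<comment> \<open>A set of measure 1 on which all other diagonal coordinates are positive; the
    inner integral is infinite at each of its points.\<close>
  define B where "B = PiE J (\<lambda>_. {0<..<1 :: real})"
  have F [measurable]: "F \<in> borel_measurable (PiM (insert (i, i) J) (\<lambda>_. lborel))"
    unfolding F_def I(1)[symmetric]
    using measurable_compose[OF borel_measurable_theta_of_coords borel_measurable_pi_kernel_Theta_G] .
  have inner: "(\<integral>\<^sup>+y. F (x((i, i) := y)) \<partial>lborel) = \<infinity>" if "x \<in> B" for x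
  proof -
    have x: "0 < x (k, k)" if "k \<noteq> i" for k
      using \<open>x \<in> B\<close> that by (auto simp: B_def PiE_iff J_def)
    let ?L = "lower_of_coords E x"
    define c where "c k = (\<Sum>a\<in>UNIV. \<Sum>b\<in>UNIV. matrix_inv ?L $ k $ a * matrix_inv ?L $ k $ b * U $ b $ a)"
      for k
    define K where "K = (\<Sum>k\<in>UNIV - {i}. c k / x (k, k)) + (\<Sum>k\<in>UNIV - {i}. \<alpha>' $ k * ln (x (k, k)))"
    \<comment> \<open>\<open>K\<close> collects the terms free of \<open>y\<close>. For
      \<open>y\<close> at least 1 the others, \<open>c i / y\<close> and
      \<open>\<alpha>' $ i * ln y\<close>, are at most \<open>\<bar>c i\<bar>\<close> and 0.\<close>
    have "ennreal (exp (- (K + \<bar>c i\<bar>) / 2)) * indicator {1 :: real..} y \<le> F (x((i, i) := y))" for y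
    proof (cases "1 \<le> y")
      case True
      have L: "lower_of_coords E (x((i, i) := y)) = ?L"
        by (auto simp: lower_of_coords_def lower_edges_def vec_eq_iff)
      have \<Theta>: "theta_of_coords E (x((i, i) := y)) \<in> Theta_G E"
        using True x by (auto simp: theta_of_coords_Theta_G_iff)
      let ?D = "diag_of_coords (\<lambda>k. (x((i, i) := y)) (k, k)) :: 'n sqmat"
      have "trace (matrix_inv (LDLt (?L, ?D)) ** U) = (\<Sum>k\<in>UNIV. c k / ?D $ k $ k)"
        unfolding c_def
        by (rule trace_inv_LDLt) (use \<Theta> L in \<open>auto simp: theta_of_coords_def Theta_G_def L_G_def\<close>)
      also have "\<dots> = c i / y + (\<Sum>k\<in>UNIV - {i}. c k / x (k, k))"
        by (subst sum.remove[of _ i]) (auto simp: diag_of_coords_def intro!: sum.cong)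
      finally have tr: "trace (matrix_inv (LDLt (?L, ?D)) ** U)
          = c i / y + (\<Sum>k\<in>UNIV - {i}. c k / x (k, k))" .
      have ln: "(\<Sum>k\<in>UNIV. \<alpha>' $ k * ln (?D $ k $ k))
          = \<alpha>' $ i * ln y + (\<Sum>k\<in>UNIV - {i}. \<alpha>' $ k * ln (x (k, k)))"
        by (subst sum.remove[of _ i]) (auto simp: diag_of_coords_def intro!: sum.cong)
      have "c i / y \<le> \<bar>c i\<bar> / y"
        using True by (intro divide_right_mono) auto
      also have "\<dots> \<le> \<bar>c i\<bar> / 1"
        using True by (intro divide_left_mono) auto
      finally have "c i / y \<le> \<bar>c i\<bar>" by simp
      moreover have "\<alpha>' $ i * ln y \<le> 0"
        using \<alpha>' True by (intro mult_nonpos_nonneg) auto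
      ultimately have "exp (- (K + \<bar>c i\<bar>) / 2) \<le> pi_kernel U \<alpha>' (?L, ?D)"
        unfolding pi_kernel_def case_prod_conv tr ln K_def by simp
      with \<Theta> True show ?thesis
        by (simp add: F_def theta_of_coords_def L ennreal_leI)
    qed simp
    then have "(\<integral>\<^sup>+y. ennreal (exp (- (K + \<bar>c i\<bar>) / 2)) * indicator {1 :: real..} y \<partial>lborel)
        \<le> (\<integral>\<^sup>+y. F (x((i, i) := y)) \<partial>lborel)"
      by (intro nn_integral_mono)
    moreover have "emeasure lborel {1 :: real..} = \<infinity>"
        proof (rule ccontr)
      assume "emeasure lborel {1 :: real..} \<noteq> \<infinity>"
      then obtain N :: nat where "emeasure lborel {1 :: real..} < of_nat N"
        using ennreal_Ex_less_of_nat by (auto simp: less_top)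
      also have "of_nat N = emeasure lborel {1..1 + real N}"
        by (simp add: emeasure_lborel_Icc_eq ennreal_of_nat_eq_real_of_nat)
      also have "\<dots> \<le> emeasure lborel {1 :: real..}"
        by (rule emeasure_mono) auto
      finally show False by simp
    qed
    then have "(\<integral>\<^sup>+y. ennreal (exp (- (K + \<bar>c i\<bar>) / 2)) * indicator {1 :: real..} y \<partial>lborel) = \<infinity>"
      by (subst nn_integral_cmult_indicator) (auto simp: ennreal_mult_top)
    ultimately show ?thesis by (simp add: top.extremum_unique)
  qed
  have B: "B \<in> sets (PiM J (\<lambda>_. lborel))" "emeasure (PiM J (\<lambda>_. lborel)) B = 1"
    unfolding B_def using I(3) by (auto intro!: sets_PiM_I_finite simp: emeasure_PiM)
  have "(\<integral>\<^sup>+x. \<infinity> * indicator B x \<partial>PiM J (\<lambda>_. lborel))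
      \<le> (\<integral>\<^sup>+x. \<integral>\<^sup>+y. F (x((i, i) := y)) \<partial>lborel \<partial>PiM J (\<lambda>_. lborel))"
    by (rule nn_integral_mono) (use inner in \<open>auto simp: indicator_def\<close>)
  also have "\<dots> = (\<integral>\<^sup>+x. F x \<partial>PiM (insert (i, i) J) (\<lambda>_. lborel))"
    by (rule product_nn_integral_insert[symmetric]) (use I F in auto)
  also have "\<dots> = z_G E U \<alpha>'"
    unfolding z_G_def F_def I(1)[symmetric]
    by (rule nn_integral_lebesgue_Theta_G[symmetric]) (rule borel_measurable_pi_kernel_Theta_G)
  finally show False
    using fin B by (simp add: nn_integral_cmult_indicator)
qed

section \<open>Equality of the two distributions on Borel sets\<close>

theorem mainTheorem8:
  fixes E :: "('n::{finite,linorder} \<times> 'n) set"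
    and Cs :: "'n set list"
    and U :: "'n sqmat"
    and \<alpha> \<beta> :: "'n set \<Rightarrow> real"
  assumes "undirected_graph E"
    and "homogeneous E"
    and "S_H E"
    and "perfect_order E Cs"
    and "U \<in> P_G E"
    and "IW_normalizable E Cs U \<alpha> \<beta>"
  shows "\<exists>\<alpha>'::'n rvec. (\<forall>i. 0 \<le> \<alpha>' $ i) \<and> z_G E U \<alpha>' < \<infinity> \<and>
           IW E Cs U \<alpha> \<beta> = pi_P_G E U \<alpha>'"
proof -
  let ?\<alpha>' = "IW_shape E Cs \<alpha> \<beta>"
  let ?K = "\<lambda>A. ennreal (IW_kernel E Cs U \<alpha> \<beta> A) * indicator (P_G E) A"
  let ?p = "\<lambda>\<theta>. ennreal (pi_kernel U ?\<alpha>' \<theta>) * indicator (Theta_G E) \<theta>"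
  note transfer = nn_integral_IW_kernel[OF assms(1,3,4), of _ U \<alpha> \<beta>]
  have const: "IW_const E Cs U \<alpha> \<beta> = z_G E U ?\<alpha>'"
    using transfer[of "\<lambda>_. 1"] by (simp add: IW_const_def z_G_def)
  then have fin: "z_G E U ?\<alpha>' < \<infinity>"
    using assms(6) by (simp add: IW_normalizable_def)
  have sets: "sets (lebesgue_P_G E) = sets borel" "sets (lebesgue_Theta_G E) = sets borel"
    by (simp_all add: lebesgue_P_G_def lebesgue_Theta_G_def)
  note [measurable] = borel_measurable_IW_kernel_P_G[of E Cs U \<alpha> \<beta>]
    borel_measurable_pi_kernel_Theta_G[of U ?\<alpha>' E] borel_measurable_LDLt
  have "IW E Cs U \<alpha> \<beta> = pi_P_G E U ?\<alpha>'"
  proof (rule measure_eqI)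
    show "sets (IW E Cs U \<alpha> \<beta>) = sets (pi_P_G E U ?\<alpha>')"
      by (simp add: IW_def pi_P_G_def sets)
    fix A assume "A \<in> sets (IW E Cs U \<alpha> \<beta>)"
    then have A [measurable]: "A \<in> sets borel"
      by (simp add: IW_def sets)
    \<comment> \<open>The common normalizing constant is put into the test function, so that
      \<open>transfer\<close> applies to the unnormalized kernels.\<close>
    let ?g = "\<lambda>S. indicator A S / z_G E U ?\<alpha>'"
    have g [measurable]: "?g \<in> borel_measurable borel"
      by measurable
    have "emeasure (IW E Cs U \<alpha> \<beta>) A = (\<integral>\<^sup>+S. ?K S * ?g S \<partial>lebesgue_P_G E)"
      unfolding IW_def const
    proof (subst emeasure_density)
      show "(\<lambda>S. ?K S / z_G E U ?\<alpha>') \<in> borel_measurable (lebesgue_P_G E)"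
        unfolding measurable_cong_sets[OF sets(1) refl] by measurable
    qed (auto simp: sets A indicator_def ennreal_times_divide intro!: nn_integral_cong)
    also have "\<dots> = (\<integral>\<^sup>+\<theta>. ?p \<theta> * ?g (LDLt \<theta>) \<partial>lebesgue_Theta_G E)"
      by (rule transfer[OF g])
    also have "\<dots> = (\<integral>\<^sup>+\<theta>. (?p \<theta> / z_G E U ?\<alpha>') * indicator (LDLt -` A) \<theta> \<partial>lebesgue_Theta_G E)"
      by (intro nn_integral_cong) (auto simp: indicator_def ennreal_times_divide)
    also have "\<dots> = emeasure (pi_Theta E U ?\<alpha>') (LDLt -` A)"
      unfolding pi_Theta_def
      by (rule emeasure_density[symmetric])
        (use measurable_sets[OF borel_measurable_LDLt A] in
          \<open>auto simp: sets cong: measurable_cong_sets\<close>)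
    also have "\<dots> = emeasure (pi_P_G E U ?\<alpha>') A"
      unfolding pi_P_G_def
      by (subst emeasure_distr)
        (auto simp: pi_Theta_def sets lebesgue_Theta_G_def cong: measurable_cong_sets)
    finally show "emeasure (IW E Cs U \<alpha> \<beta>) A = emeasure (pi_P_G E U ?\<alpha>') A" .
  qed
  with fin z_G_finite_imp_pos[OF fin] show ?thesis
    by (metis less_imp_le)
qed

end
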